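(* Let $n,w\ge1$ and let $f\colon\mathbb{R}^n\to\mathbb{R}$ be a non-constant function given by $$f(x)=c_0+\sum_{k=1}^w d_k\,\sigma(a_k^{\top}x+b_k),$$ where $\sigma(u)=(1+e^{-u})^{-1}$ is the logistic sigmoid, $c_0,b_k,d_k\in\mathbb{R}$, and the $a_k\in\mathbb{Q}^n$ have common denominator $q\in\mathbb{N}_{>0}$ (i.e. $q\,a_k\in\mathbb{Z}^n$ for all $k$). Set $V=\{x:f(x)=0\}$ and $L=q\max_{k,i}|a_{ki}|$. If $V$ is a smooth compact hypersurface and $\nabla f$ is non-vanishing on $V$, then $$\mathrm{mdeg}(V)\le C(n,L)\cdot w^n,$$ where $C(n,L)\le 2\cdot n!\,(2L)^n$ depends only on $n$ and $L$.
   Context: Gauss-map degree: for a smooth hypersurface $V\subset\mathbb{R}^n$, let $S(NV)=\{(x,u)\in V\times S^{n-1}: u\perp T_xV\}$ be the normal sphere bundle and $\gamma\colon S(NV)\to S^{n-1}$, $(x,u)\mapsto u$, the generalised Gauss map. Then $\mathrm{mdeg}(V)=\sup\{|\gamma^{-1}(v)|: v\in S^{n-1}\text{ a regular value of }\gamma\}$. *)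

theory Defs
  imports "HOL-Analysis.Analysis"
begin

definition sigmoid :: "real \<Rightarrow> real" where
  "sigmoid u = inverse (1 + exp (- u))"

text \<open>\<open>C\<^sup>k\<close> and smooth maps on an open set: in the successor step every directional derivative
  is required to be \<open>C\<^sup>k\<close>. Neither notion is meant for sets that are not open.\<close>

primrec Ck_on :: "nat \<Rightarrow> ('a::real_normed_vector \<Rightarrow> 'b::real_normed_vector) \<Rightarrow> 'a set \<Rightarrow> bool" where
  "Ck_on 0 f S \<longleftrightarrow> continuous_on S f"
| "Ck_on (Suc k) f S \<longleftrightarrow>
     (\<forall>x\<in>S. f differentiable (at x)) \<and> (\<forall>v. Ck_on k (\<lambda>x. frechet_derivative f (at x) v) S)"

definition smooth_on :: "('a::real_normed_vector \<Rightarrow> 'b::real_normed_vector) \<Rightarrow> 'a set \<Rightarrow> bool" where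
  "smooth_on f S \<longleftrightarrow> (\<forall>k. Ck_on k f S)"

text \<open>Embedded submanifolds without boundary, by slice charts. The empty set is allowed.\<close>

definition smooth_submanifold :: "nat \<Rightarrow> 'a::euclidean_space set \<Rightarrow> bool" where
  "smooth_submanifold d M \<longleftrightarrow>
     (\<forall>x\<in>M. \<exists>U W \<phi> \<psi> H.
        open U \<and> x \<in> U \<and> open W \<and>
        homeomorphism U W \<phi> \<psi> \<and> smooth_on \<phi> U \<and> smooth_on \<psi> W \<and>
        subspace (H :: 'a set) \<and> dim H = d \<and> \<phi> ` (M \<inter> U) = W \<inter> H)"

definition smooth_hypersurface :: "'a::euclidean_space set \<Rightarrow> bool" where
  "smooth_hypersurface V \<longleftrightarrow> smooth_submanifold (DIM('a) - 1) V"

text \<open>The tangent space as a linear subspace of the ambient space: velocities at time 0 of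
  smooth curves lying in the submanifold and passing through the point.\<close>

definition tangent_space :: "'a::euclidean_space set \<Rightarrow> 'a \<Rightarrow> 'a set" where
  "tangent_space M x =
     {t. \<exists>c \<epsilon>. \<epsilon> > 0 \<and> smooth_on c {-\<epsilon><..<\<epsilon>} \<and> c ` {-\<epsilon><..<\<epsilon>} \<subseteq> M \<and>
             c 0 = x \<and> (c has_vector_derivative t) (at (0::real))}"

text \<open>Regular values of the restriction \<open>g : M \<rightarrow> N\<close> of a smooth map \<open>g\<close> of the ambient spaces;
  the differential of the restriction is the restriction of the ambient differential.
  Points of \<open>N\<close> outside the image of \<open>M\<close> are regular values.\<close>

definition regular_value ::
  "('a::euclidean_space \<Rightarrow> 'b::euclidean_space) \<Rightarrow> 'a set \<Rightarrow> 'b set \<Rightarrow> 'b \<Rightarrow> bool" where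
  "regular_value g M N v \<longleftrightarrow> v \<in> N \<and>
     (\<forall>p\<in>M. g p = v \<longrightarrow> frechet_derivative g (at p) ` tangent_space M p = tangent_space N v)"

definition normal_sphere_bundle :: "'a::euclidean_space set \<Rightarrow> ('a \<times> 'a) set" where
  "normal_sphere_bundle V =
     {(x, u). x \<in> V \<and> u \<in> sphere 0 1 \<and> (\<forall>t\<in>tangent_space V x. orthogonal u t)}"

definition gauss_map :: "'a::euclidean_space \<times> 'a \<Rightarrow> 'a" where
  "gauss_map = (\<lambda>(x, u). u)"

definition ecard :: "'a set \<Rightarrow> enat" where
  "ecard A = (if finite A then enat (card A) else \<infinity>)"

definition mdeg :: "'a::euclidean_space set \<Rightarrow> enat" where
  "mdeg V =
     (SUP v \<in> {v. regular_value gauss_map (normal_sphere_bundle V) (sphere 0 1) v}.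
        ecard {p \<in> normal_sphere_bundle V. gauss_map p = v})"

end

theory Submission
  imports Defs
begin

text \<open>For a unit vector \<open>v\<close>, a point \<open>(x, v)\<close> lies in the normal sphere bundle iff \<open>x\<close> is a zero of
  \<open>Q = f v + \<pi> (\<nabla> f)\<close>, where \<open>\<pi>\<close> is the orthogonal projection along \<open>v\<close>. If \<open>v\<close> is a regular value,
  then \<open>Q\<close> has a surjective derivative at these zeros. Multiplication by the squares of the
  denominators of the sigmoids turns the components of \<open>Q\<close> into polynomials in \<open>exp (x\<^sub>i / q)\<close> of degree
  at most \<open>D = 2 L w\<close> in each variable.

  A system \<open>P\<close> of \<open>n\<close> such polynomials has at most \<open>e = n! D\<^sup>n\<close> nondegenerate zeros: choose \<open>h\<close> of degree 1 in
  each variable that separates the zeros. Comparing the number of products \<open>P\<^sup>\<alpha> h\<^sup>j\<close> with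
  \<open>\<bar>\<alpha>\<bar> \<le> m\<close>, \<open>j \<le> e\<close> with the dimension of the space they lie in yields, for large \<open>m\<close>, a nontrivial
  relation \<open>A (P, h) = 0\<close> of degree at most \<open>e\<close> in \<open>h\<close>. For a generic small \<open>c\<close>, the equation \<open>P = c\<close> has a
  solution near every nondegenerate zero, and the values of \<open>h\<close> at these solutions are distinct roots of the
  nonzero polynomial \<open>A (c, t)\<close> in \<open>t\<close>.\<close>

section \<open>Counting\<close>

text \<open>Gaussian elimination: an equation with a nonzero coefficient at \<open>k\<close>
  expresses \<open>l k\<close> through the other unknowns, so one equation and one unknown disappear
  together.\<close>

lemma homogeneous_system_nontrivial_solution:
  fixes c :: "'i \<Rightarrow> 'b \<Rightarrow> 'a::field"
  assumes "finite B" "finite I" "card B < card I"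
  shows "\<exists>l. (\<exists>i\<in>I. l i \<noteq> 0) \<and> (\<forall>b\<in>B. (\<Sum>i\<in>I. l i * c i b) = 0)"
  using assms
proof (induction B arbitrary: I c rule: finite_induct)
  case empty
  then obtain i where "i \<in> I" by fastforce
  then show ?case by (intro exI[of _ "\<lambda>_. 1"]) auto
next
  case (insert b B)
  show ?case
  proof (cases "\<forall>i\<in>I. c i b = 0")
    case True
    have "card B < card I" using insert by simp
    from insert.IH[OF insert.prems(1) this, of c] True show ?thesis
      by (force intro: sum.neutral)
  next
    case False
    then obtain k where k: "k \<in> I" "c k b \<noteq> 0" by blast
    define J where "J = I - {k}"
    have J: "finite J" "I = insert k J" "k \<notin> J" using k insert.prems(1) by (auto simp: J_def)
    have "card B < card J" using insert J by simp
    from insert.IH[OF J(1) this, of "\<lambda>i x. c i x - c i b / c k b * c k x"] obtain l where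
      l: "\<exists>i\<in>J. l i \<noteq> 0"
         "\<And>x. x \<in> B \<Longrightarrow> (\<Sum>i\<in>J. l i * (c i x - c i b / c k b * c k x)) = 0" by blast
    \<comment> \<open>The value at \<open>k\<close> is the one forced by equation \<open>b\<close>.
      Substituting it turns every original equation into an equation of the reduced system.\<close>
    define l' where "l' = l(k := - (\<Sum>i\<in>J. l i * c i b) / c k b)"
    have sum: "(\<Sum>i\<in>I. l' i * c i x) = (\<Sum>i\<in>J. l i * (c i x - c i b / c k b * c k x))" for x
    proof -
      have "(\<Sum>i\<in>J. l' i * c i x) = (\<Sum>i\<in>J. l i * c i x)"
        using J(3) by (intro sum.cong) (auto simp: l'_def)
      then have "(\<Sum>i\<in>I. l' i * c i x) =
          - (\<Sum>i\<in>J. l i * c i b) / c k b * c k x + (\<Sum>i\<in>J. l i * c i x)"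
        using J by (simp add: l'_def)
      also have "\<dots> = (\<Sum>i\<in>J. l i * (c i x - c i b / c k b * c k x))"
        by (simp add: right_diff_distrib sum_subtractf sum_distrib_right sum_divide_distrib mult.assoc)
      finally show ?thesis .
    qed
    have "(\<Sum>i\<in>I. l' i * c i x) = 0" if "x \<in> insert b B" for x
    proof (cases "x = b")
      case True
      then show ?thesis unfolding sum using k by simp
    next
      case False
      then show ?thesis unfolding sum using that l(2) by simp
    qed
    moreover have "\<exists>i\<in>I. l' i \<noteq> 0" using l(1) J by (auto simp: l'_def)
    ultimately show ?thesis by blast
  qed
qed

lemma finite_bounded_funs: "finite {\<alpha> :: 'n::finite \<Rightarrow> nat. \<forall>i. \<alpha> i \<le> D}"
  and card_bounded_funs: "card {\<alpha> :: 'n::finite \<Rightarrow> nat. \<forall>i. \<alpha> i \<le> D} = (D + 1) ^ CARD('n)"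
proof -
  have eq: "{\<alpha> :: 'n \<Rightarrow> nat. \<forall>i. \<alpha> i \<le> D} = PiE UNIV (\<lambda>_. {..D})" by (auto simp: PiE_def)
  show "finite {\<alpha> :: 'n \<Rightarrow> nat. \<forall>i. \<alpha> i \<le> D}" unfolding eq by (intro finite_PiE) auto
  show "card {\<alpha> :: 'n \<Rightarrow> nat. \<forall>i. \<alpha> i \<le> D} = (D + 1) ^ CARD('n)"
    unfolding eq by (subst card_PiE) auto
qed

lemma finite_degree_le: "finite {\<alpha> :: 'n::finite \<Rightarrow> nat. sum \<alpha> UNIV \<le> m}"
proof (rule finite_subset[OF _ finite_bounded_funs[of m]], clarify)
  fix \<alpha> :: "'n \<Rightarrow> nat" and i assume "sum \<alpha> UNIV \<le> m"
  moreover have "\<alpha> i \<le> sum \<alpha> UNIV" by (rule member_le_sum) auto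
  ultimately show "\<alpha> i \<le> m" by linarith
qed

text \<open>Stars and bars: lists of \<open>n + 1\<close> naturals with sum \<open>m\<close> are
  mapped to exponents by dropping the last entry. That entry is the slack
  \<open>m - sum \<alpha> UNIV\<close>, so the map is injective.\<close>

lemma card_degree_le: "(m + CARD('n)) choose CARD('n) \<le> card {\<alpha> :: 'n::finite \<Rightarrow> nat. sum \<alpha> UNIV \<le> m}"
proof -
  define n where "n = CARD('n)"
  obtain e :: "'n \<Rightarrow> nat" where e: "bij_betw e UNIV {0..<n}"
    using ex_bij_betw_finite_nat[of "UNIV :: 'n set"] unfolding n_def by auto
  define L where "L = {l :: nat list. length l = n + 1 \<and> sum_list l = m}"
  have sum_list: "sum_list l = (\<Sum>i\<in>UNIV. l ! e i) + l ! n" if "length l = n + 1" for l :: "nat list"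
  proof -
    have "sum_list l = (\<Sum>i\<in>{0..<n}. l ! i) + l ! n"
      using that by (simp add: sum_list_sum_nth)
    then show ?thesis using sum.reindex_bij_betw[OF e, of "\<lambda>i. l ! i"] by simp
  qed
  have "inj_on (\<lambda>l i. l ! e i) L"
  proof (rule inj_onI)
    fix l l' assume A: "l \<in> L" "l' \<in> L" "(\<lambda>i. l ! e i) = (\<lambda>i. l' ! e i)"
    then have eq: "l ! e i = l' ! e i" for i by metis
    have "l ! n = l' ! n" using A(1,2) sum_list[of l] sum_list[of l'] eq by (auto simp: L_def)
    moreover have "l ! k = l' ! k" if "k < n" for k
      using that eq bij_betw_imp_surj_on[OF e] by (metis atLeastLessThan_iff imageE zero_le)
    ultimately show "l = l'" using A(1,2)
      by (intro nth_equalityI) (auto simp: L_def less_Suc_eq)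
  qed
  moreover have "(\<lambda>l i. l ! e i) ` L \<subseteq> {\<alpha>. sum \<alpha> UNIV \<le> m}"
    using sum_list by (auto simp: L_def)
  ultimately have "card L \<le> card {\<alpha> :: 'n \<Rightarrow> nat. sum \<alpha> UNIV \<le> m}"
    using card_inj_on_le finite_degree_le by blast
  moreover have "card L = (m + n) choose n"
    using card_length_sum_list[of "n + 1" m] binomial_symmetric[of m "m + n"] by (simp add: L_def)
  ultimately show ?thesis by (simp add: n_def)
qed

text \<open>The right side is the product of the \<open>n\<close> factors
  \<open>m + 1, ..., m + n\<close>.\<close>

lemma power_le_fact_mult_binomial: "m ^ n \<le> fact n * ((m + n) choose n)"
proof -
  have "m ^ n * fact m \<le> (fact (m + n) :: nat)"
  proof (induction n)
    case (Suc n)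
    have "m ^ Suc n * fact m = m * (m ^ n * fact m)" by simp
    also have "\<dots> \<le> Suc (m + n) * fact (m + n)" by (intro mult_mono Suc) auto
    finally show ?case by simp
  qed simp
  also have "\<dots> = fact n * ((m + n) choose n) * fact m"
    using binomial_fact_lemma[of n "m + n"] by (simp add: ac_simps)
  finally show ?thesis by simp
qed

text \<open>After multiplication by \<open>fact n\<close> and division by \<open>m ^ n\<close>, the
  left side tends to \<open>fact n * D ^ n = e\<close>, while the right side stays at least
  \<open>e + 1\<close>. This comparison fixes the value of \<open>e\<close>.\<close>

lemma exists_large_degree:
  fixes D n e :: nat
  assumes "e = fact n * D ^ n"
  shows "\<exists>m. (D * m + e + 1) ^ n < ((m + n) choose n) * (e + 1)"
proof -
  have "(\<lambda>m. fact n * (real D + (real e + 1) / real m) ^ n) \<longlonglongrightarrow> fact n * (real D + 0) ^ n"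
    by (intro tendsto_intros real_tendsto_divide_at_top filterlim_real_sequentially)
  moreover have "fact n * (real D + 0) ^ n < real e + 1"
    unfolding assms by simp
  ultimately have "eventually (\<lambda>m. fact n * (real D + (real e + 1) / real m) ^ n < real e + 1) sequentially"
    by (rule order_tendstoD)
  then have "eventually (\<lambda>m. m > 0 \<and> fact n * (real D + (real e + 1) / real m) ^ n < real e + 1) sequentially"
    by (intro eventually_conj eventually_gt_at_top)
  then obtain m where m: "m > 0" "fact n * (real D + (real e + 1) / real m) ^ n < real e + 1"
    using eventually_happens'[OF sequentially_bot] by blast
  have "real D * real m + (real e + 1) = (real D + (real e + 1) / real m) * real m"
    using m(1) by (simp add: field_simps)
  then have "fact n * (real D * real m + (real e + 1)) ^ n =
      fact n * (real D + (real e + 1) / real m) ^ n * real m ^ n"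
    by (simp add: power_mult_distrib)
  also have "\<dots> < (real e + 1) * real m ^ n"
    using m by (intro mult_strict_right_mono) auto
  also have "\<dots> \<le> (real e + 1) * (fact n * real ((m + n) choose n))"
  proof -
    have "real (m ^ n) \<le> real (fact n * ((m + n) choose n))"
      using power_le_fact_mult_binomial of_nat_le_iff by blast
    then show ?thesis by (intro mult_left_mono) auto
  qed
  finally have "fact n * real ((D * m + e + 1) ^ n) < fact n * real (((m + n) choose n) * (e + 1))"
    by (simp add: algebra_simps)
  then have "real ((D * m + e + 1) ^ n) < real (((m + n) choose n) * (e + 1))"
    by simp
  then show ?thesis using of_nat_less_iff by blast
qed

section \<open>Independence of monomials\<close>

text \<open>Finitely many hyperplanes through the origin form a null set, which cannot cover a
  nonempty open set. This supplies the generic weights and the generic linear forms used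
  below.\<close>

lemma exists_nonorthogonal:
  fixes F U :: "'a::euclidean_space set"
  assumes "finite F" "0 \<notin> F" "open U" "U \<noteq> {}"
  shows "\<exists>s\<in>U. \<forall>a\<in>F. a \<bullet> s \<noteq> 0"
proof (rule ccontr)
  assume "\<not> ?thesis"
  then have "U \<subseteq> (\<Union>a\<in>F. {x. a \<bullet> x = 0})" by blast
  moreover have "negligible (\<Union>a\<in>F. {x. a \<bullet> x = 0})"
    using assms(1,2) by (intro negligible_Union finite_imageI) (auto intro!: negligible_hyperplane)
  ultimately show False
    using assms(3,4) negligible_subset open_not_negligible by blast
qed

definition monomial_fun :: "('n::finite \<Rightarrow> nat) \<Rightarrow> real ^ 'n \<Rightarrow> real" where
  "monomial_fun \<alpha> c = (\<Prod>i\<in>UNIV. c $ i ^ \<alpha> i)"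

lemma tendsto_exp_neg_mult_at_top:
  fixes a :: real
  assumes "a > 0"
  shows "((\<lambda>t. exp (- (t * a))) \<longlongrightarrow> 0) at_top"
proof -
  have "filterlim (\<lambda>t. a * t) at_top at_top"
    using filterlim_tendsto_pos_mult_at_top[OF tendsto_const assms filterlim_ident] by simp
  then have "filterlim (\<lambda>t. - (t * a)) at_bot at_top"
    by (simp add: filterlim_uminus_at_bot mult.commute)
  then show ?thesis by (rule filterlim_compose[OF exp_at_bot])
qed

text \<open>Along the curve \<open>c\<^sub>i = exp (- T s\<^sub>i)\<close> with generic \<open>s\<close>, one monomial dominates all others
  as \<open>T\<close> tends to infinity.\<close>

lemma monomial_funs_independent_ball:
  fixes l :: "('n::finite \<Rightarrow> nat) \<Rightarrow> real"
  assumes A: "finite A" and r: "r > 0"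
    and zero: "\<And>c. norm c < r \<Longrightarrow> (\<Sum>\<alpha>\<in>A. l \<alpha> * monomial_fun \<alpha> c) = 0"
    and \<alpha>: "\<alpha> \<in> A"
  shows "l \<alpha> = 0"
proof (rule ccontr)
  assume "l \<alpha> \<noteq> 0"
  define V where "V = (\<lambda>\<alpha> :: 'n \<Rightarrow> nat. (\<chi> i. real (\<alpha> i)) :: real ^ 'n)"
  \<comment> \<open>Avoiding orthogonality to these differences gives distinct exponents distinct
    weights \<open>V \<alpha> \<bullet> s\<close>.\<close>
  define F where "F = (\<lambda>(\<alpha>, \<beta>). V \<alpha> - V \<beta>) ` (A \<times> A) - {0}"
  have V_inj: "\<alpha> = \<beta>" if "V \<alpha> = V \<beta>" for \<alpha> \<beta>
    using that by (auto simp: V_def vec_eq_iff)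
  \<comment> \<open>Positive weights make the curve tend to the origin, so that it finally stays in
    the given ball.\<close>
  define U where "U = {s :: real ^ 'n. \<forall>i. 0 < s $ i}"
  have "U = (\<Inter>i. {s. 0 < s $ i})" by (auto simp: U_def)
  then have "open U" by (auto intro!: open_INT open_Collect_less continuous_intros)
  moreover have "(\<chi> i. 1) \<in> U" by (auto simp: U_def)
  moreover have "finite F" "0 \<notin> F" using A by (auto simp: F_def)
  ultimately have "\<exists>s\<in>U. \<forall>a\<in>F. a \<bullet> s \<noteq> 0" by (intro exists_nonorthogonal) blast+
  then obtain s where s: "s \<in> U" "\<And>a. a \<in> F \<Longrightarrow> a \<bullet> s \<noteq> 0" by blast
  define A' where "A' = {\<beta> \<in> A. l \<beta> \<noteq> 0}"
  have "finite A'" "A' \<noteq> {}" using A \<alpha> \<open>l \<alpha> \<noteq> 0\<close> by (auto simp: A'_def)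
  then obtain \<beta> where \<beta>: "\<beta> \<in> A'" "\<And>\<gamma>. \<gamma> \<in> A' \<Longrightarrow> V \<beta> \<bullet> s \<le> V \<gamma> \<bullet> s"
    using ex_is_arg_min_if_finite[of A' "\<lambda>\<gamma>. V \<gamma> \<bullet> s"] by (auto simp: is_arg_min_linorder)
  define c where "c = (\<lambda>T. (\<chi> i. exp (- (T * s $ i))) :: real ^ 'n)"
  have mono_c: "monomial_fun \<gamma> (c T) = exp (- (T * (V \<gamma> \<bullet> s)))" for \<gamma> T
  proof -
    have "monomial_fun \<gamma> (c T) = (\<Prod>i\<in>UNIV. exp (- (T * (real (\<gamma> i) * s $ i))))"
      unfolding monomial_fun_def c_def by (intro prod.cong) (auto simp: exp_of_nat_mult[symmetric])
    also have "\<dots> = exp (\<Sum>i\<in>UNIV. - (T * (real (\<gamma> i) * s $ i)))"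
      by (simp add: exp_sum)
    finally show ?thesis by (simp add: V_def inner_vec_def sum_negf sum_distrib_left)
  qed
  have "(c \<longlongrightarrow> 0) at_top"
  proof (rule vec_tendstoI)
    fix i
    have "s $ i > 0" using s(1) by (auto simp: U_def)
    then have "((\<lambda>T. exp (- (T * s $ i))) \<longlongrightarrow> 0) at_top"
      by (rule tendsto_exp_neg_mult_at_top)
    then show "((\<lambda>T. c T $ i) \<longlongrightarrow> 0 $ i) at_top" by (simp add: c_def)
  qed
  then have "((\<lambda>T. norm (c T)) \<longlongrightarrow> 0) at_top" by (rule tendsto_norm_zero)
  then have small: "eventually (\<lambda>T. norm (c T) < r) at_top"
    using r by (rule order_tendstoD)
  \<comment> \<open>The vanishing sum is divided by its slowest decaying monomial, that of
    \<open>\<beta>\<close>. All other terms then tend to 0, and the limit is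
    \<open>l \<beta>\<close>.\<close>
  define g where "g = (\<lambda>T. \<Sum>\<gamma>\<in>A'. l \<gamma> * exp (- (T * (V \<gamma> \<bullet> s - V \<beta> \<bullet> s))))"
  have "eventually (\<lambda>T. g T = 0) at_top"
    using small
  proof eventually_elim
    case (elim T)
    have "g T = exp (T * (V \<beta> \<bullet> s)) * (\<Sum>\<gamma>\<in>A'. l \<gamma> * exp (- (T * (V \<gamma> \<bullet> s))))"
      unfolding g_def sum_distrib_left
      by (intro sum.cong refl) (simp add: right_diff_distrib exp_diff exp_minus divide_simps)
    also have "(\<Sum>\<gamma>\<in>A'. l \<gamma> * exp (- (T * (V \<gamma> \<bullet> s)))) = (\<Sum>\<gamma>\<in>A. l \<gamma> * monomial_fun \<gamma> (c T))"
      unfolding mono_c A'_def using A by (intro sum.mono_neutral_left) auto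
    also have "\<dots> = 0" using zero elim by blast
    finally show ?case by simp
  qed
  then have "(g \<longlongrightarrow> 0) at_top" by (rule tendsto_eventually)
  moreover have "(g \<longlongrightarrow> (\<Sum>\<gamma>\<in>A'. if \<gamma> = \<beta> then l \<beta> else 0)) at_top"
    unfolding g_def
  proof (rule tendsto_sum)
    fix \<gamma> assume \<gamma>: "\<gamma> \<in> A'"
    show "((\<lambda>T. l \<gamma> * exp (- (T * (V \<gamma> \<bullet> s - V \<beta> \<bullet> s)))) \<longlongrightarrow> (if \<gamma> = \<beta> then l \<beta> else 0)) at_top"
    proof (cases "\<gamma> = \<beta>")
      case False
      then have "V \<gamma> - V \<beta> \<in> F" using \<gamma> \<beta> V_inj by (auto simp: F_def A'_def)
      then have "V \<gamma> \<bullet> s - V \<beta> \<bullet> s > 0"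
        using s(2)[of "V \<gamma> - V \<beta>"] \<beta>(2)[OF \<gamma>] by (auto simp: inner_diff_left)
      then have "((\<lambda>T. exp (- (T * (V \<gamma> \<bullet> s - V \<beta> \<bullet> s)))) \<longlongrightarrow> 0) at_top"
        by (rule tendsto_exp_neg_mult_at_top)
      then show ?thesis using False tendsto_mult_right_zero by auto
    qed auto
  qed
  ultimately have "(\<Sum>\<gamma>\<in>A'. if \<gamma> = \<beta> then l \<beta> else 0) = 0"
    using tendsto_unique trivial_limit_at_top_linorder by blast
  then show False using \<open>finite A'\<close> \<beta>(1) by (auto simp: A'_def)
qed

section \<open>Exponential polynomials\<close>

definition exp_monomial :: "real \<Rightarrow> ('n::finite \<Rightarrow> nat) \<Rightarrow> real ^ 'n \<Rightarrow> real" where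
  "exp_monomial r \<beta> x = exp (r * (\<Sum>i\<in>UNIV. real (\<beta> i) * x $ i))"

text \<open>These are the polynomials in the variables \<open>exp (r * x $ i)\<close>, with degree
  at most \<open>D\<close> in each variable separately. Bounding the degree per variable makes the
  dimension count a plain power of \<open>D + 1\<close>.\<close>

inductive_set exp_poly :: "real \<Rightarrow> nat \<Rightarrow> (real ^ 'n \<Rightarrow> real) set" for r D where
  monom: "(\<And>i. \<beta> i \<le> D) \<Longrightarrow> (\<lambda>x. c * exp_monomial r \<beta> x) \<in> exp_poly r D"
| add: "F \<in> exp_poly r D \<Longrightarrow> G \<in> exp_poly r D \<Longrightarrow> (\<lambda>x. F x + G x) \<in> exp_poly r D"

lemma exp_monomial_mult:
  "exp_monomial r \<beta> x * exp_monomial r \<gamma> x = exp_monomial r (\<lambda>i. \<beta> i + \<gamma> i) x"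
proof -
  have "(\<Sum>i\<in>UNIV. real (\<beta> i + \<gamma> i) * x $ i) =
      (\<Sum>i\<in>UNIV. real (\<beta> i) * x $ i) + (\<Sum>i\<in>UNIV. real (\<gamma> i) * x $ i)"
    by (simp add: distrib_right sum.distrib)
  then show ?thesis unfolding exp_monomial_def by (simp add: distrib_left exp_add)
qed

lemma exp_poly_const: "(\<lambda>x. c) \<in> exp_poly r D"
proof -
  have "(\<lambda>x. c * exp_monomial r (\<lambda>_. 0) x) \<in> exp_poly r D" by (rule exp_poly.monom) simp
  then show ?thesis by (simp add: exp_monomial_def)
qed

lemma exp_poly_mono: "F \<in> exp_poly r D" if "F \<in> exp_poly r D'" "D' \<le> D"
  using that
proof induction
  case (monom \<beta> c)
  then show ?case by (intro exp_poly.monom) (meson order_trans)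
qed (auto intro: exp_poly.add)

lemma exp_poly_mult:
  assumes "F \<in> exp_poly r D" "G \<in> exp_poly r D'"
  shows "(\<lambda>x. F x * G x) \<in> exp_poly r (D + D')"
  using assms(1)
proof (induction rule: exp_poly.induct)
  case (monom \<beta> c)
  from assms(2) show ?case
  proof (induction rule: exp_poly.induct)
    case (monom \<gamma> c')
    have "(\<lambda>x. (c * c') * exp_monomial r (\<lambda>i. \<beta> i + \<gamma> i) x) \<in> exp_poly r (D + D')"
      by (intro exp_poly.monom add_mono) (use monom \<open>\<And>i. \<beta> i \<le> D\<close> in auto)
    moreover have "(\<lambda>x. c * exp_monomial r \<beta> x * (c' * exp_monomial r \<gamma> x)) =
        (\<lambda>x. (c * c') * exp_monomial r (\<lambda>i. \<beta> i + \<gamma> i) x)"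
      unfolding exp_monomial_mult[symmetric] by (simp add: mult_ac)
    ultimately show ?case by simp
  next
    case (add F G)
    from exp_poly.add[OF add.IH] show ?case by (simp add: distrib_left)
  qed
next
  case (add F G)
  from exp_poly.add[OF add.IH] show ?case by (simp add: distrib_right)
qed

lemma exp_poly_cmult: "(\<lambda>x. c * F x) \<in> exp_poly r D" if "F \<in> exp_poly r D"
  using exp_poly_mult[OF exp_poly_const[of c r 0] that] by simp

lemma exp_poly_sum:
  assumes "\<And>i. i \<in> I \<Longrightarrow> F i \<in> exp_poly r D"
  shows "(\<lambda>x. \<Sum>i\<in>I. F i x) \<in> exp_poly r D"
  using assms
proof (induction I rule: infinite_finite_induct)
  case (insert i I)
  then show ?case by (simp add: exp_poly.add)
qed (simp_all add: exp_poly_const)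

lemma exp_poly_prod:
  assumes "finite I" "\<And>i. i \<in> I \<Longrightarrow> F i \<in> exp_poly r (D i)"
  shows "(\<lambda>x. \<Prod>i\<in>I. F i x) \<in> exp_poly r (sum D I)"
  using assms
proof (induction I rule: finite_induct)
  case (insert i I)
  then show ?case by (simp add: exp_poly_mult)
qed (simp add: exp_poly_const)

lemma exp_poly_power: "(\<lambda>x. F x ^ k) \<in> exp_poly r (D * k)" if "F \<in> exp_poly r D"
  using exp_poly_prod[of "{..<k}" "\<lambda>_. F" r "\<lambda>_. D"] that by (simp add: mult.commute)

lemma exp_poly_continuous: "continuous_on S F" if "F \<in> exp_poly r D"
  using that
proof induction
  case (monom \<beta> c)
  show ?case unfolding exp_monomial_def by (intro continuous_intros)
next
  case (add F G)
  then show ?case by (intro continuous_on_add)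
qed

lemma exp_poly_differentiable: "F differentiable (at x)" if "F \<in> exp_poly r D"
  using that
proof induction
  case (monom \<beta> c)
  have "exp_monomial r \<beta> = (\<lambda>y. exp (r * ((\<chi> i. real (\<beta> i)) \<bullet> y)))"
    by (rule ext) (simp add: exp_monomial_def inner_vec_def)
  moreover have "((\<lambda>y. c * exp (r * (z \<bullet> y))) has_derivative (\<lambda>h. c * (exp (r * (z \<bullet> x)) * (r * (z \<bullet> h))))) (at x)" for z
    by (auto intro!: derivative_eq_intros)
  ultimately show ?case unfolding differentiable_def by auto
qed (rule differentiable_add)

text \<open>Coordinates with respect to the \<open>(D + 1) ^ n\<close> monomials: this is how the
  inductive description yields a bound on the dimension.\<close>

lemma exp_poly_expansion:
  assumes "F \<in> exp_poly r D"
  shows "\<exists>c. \<forall>x. F x = (\<Sum>\<beta>\<in>{\<beta>. \<forall>i. \<beta> i \<le> D}. c \<beta> * exp_monomial r \<beta> x)"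
  using assms
proof induction
  case (monom \<gamma> c)
  have "c * exp_monomial r \<gamma> x =
      (\<Sum>\<beta>\<in>{\<beta>. \<forall>i. \<beta> i \<le> D}. (if \<beta> = \<gamma> then c else 0) * exp_monomial r \<beta> x)" for x
  proof -
    have "(\<Sum>\<beta>\<in>{\<beta>. \<forall>i. \<beta> i \<le> D}. (if \<beta> = \<gamma> then c else 0) * exp_monomial r \<beta> x) =
        (\<Sum>\<beta>\<in>{\<beta>. \<forall>i. \<beta> i \<le> D}. if \<beta> = \<gamma> then c * exp_monomial r \<beta> x else 0)"
      by (intro sum.cong) auto
    then show ?thesis using monom by (simp add: finite_bounded_funs)
  qed
  then show ?case by (intro exI[of _ "\<lambda>\<beta>. if \<beta> = \<gamma> then c else 0"]) blast
next
  case (add F G)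
  then obtain c c' where
    "\<And>x. F x = (\<Sum>\<beta>\<in>{\<beta>. \<forall>i. \<beta> i \<le> D}. c \<beta> * exp_monomial r \<beta> x)"
    "\<And>x. G x = (\<Sum>\<beta>\<in>{\<beta>. \<forall>i. \<beta> i \<le> D}. c' \<beta> * exp_monomial r \<beta> x)" by blast
  then have "F x + G x = (\<Sum>\<beta>\<in>{\<beta>. \<forall>i. \<beta> i \<le> D}. (c \<beta> + c' \<beta>) * exp_monomial r \<beta> x)" for x
    by (simp add: sum.distrib distrib_right)
  then show ?case by (intro exI[of _ "\<lambda>\<beta>. c \<beta> + c' \<beta>"]) auto
qed

lemma exp_poly_linear_dependence:
  fixes F :: "'i \<Rightarrow> real ^ 'n \<Rightarrow> real"
  assumes I: "finite I" "(D + 1) ^ CARD('n) < card I"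
    and F: "\<And>i. i \<in> I \<Longrightarrow> F i \<in> exp_poly r D"
  shows "\<exists>l. (\<exists>i\<in>I. l i \<noteq> 0) \<and> (\<forall>x. (\<Sum>i\<in>I. l i * F i x) = 0)"
proof -
  let ?B = "{\<beta> :: 'n \<Rightarrow> nat. \<forall>i. \<beta> i \<le> D}"
  have "\<forall>i\<in>I. \<exists>c. \<forall>x. F i x = (\<Sum>\<beta>\<in>?B. c \<beta> * exp_monomial r \<beta> x)"
    using exp_poly_expansion[OF F] by blast
  from bchoice[OF this] obtain c where
    c: "\<And>i x. i \<in> I \<Longrightarrow> F i x = (\<Sum>\<beta>\<in>?B. c i \<beta> * exp_monomial r \<beta> x)" by blast
  obtain l where l: "\<exists>i\<in>I. l i \<noteq> 0" "\<And>\<beta>. \<beta> \<in> ?B \<Longrightarrow> (\<Sum>i\<in>I. l i * c i \<beta>) = 0"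
    using homogeneous_system_nontrivial_solution[of ?B I c] I
    by (auto simp: finite_bounded_funs card_bounded_funs)
  have "(\<Sum>i\<in>I. l i * F i x) = 0" for x
  proof -
    have "(\<Sum>i\<in>I. l i * F i x) = (\<Sum>i\<in>I. \<Sum>\<beta>\<in>?B. l i * c i \<beta> * exp_monomial r \<beta> x)"
      by (intro sum.cong refl) (simp add: c sum_distrib_left mult.assoc)
    also have "\<dots> = (\<Sum>\<beta>\<in>?B. (\<Sum>i\<in>I. l i * c i \<beta>) * exp_monomial r \<beta> x)"
      by (subst sum.swap) (simp add: sum_distrib_right)
    also have "\<dots> = 0" using l(2) by (intro sum.neutral ballI) simp
    finally show ?thesis .
  qed
  with l(1) show ?thesis by blast
qed

lemma exp_poly_separating:
  fixes S :: "(real ^ 'n) set"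
  assumes "finite S" "r \<noteq> 0"
  shows "\<exists>h\<in>exp_poly r 1. inj_on h S"
proof -
  define E where "E = (\<lambda>x :: real ^ 'n. (\<chi> i. exp (r * x $ i)) :: real ^ 'n)"
  have E_inj: "x = y" if "E x = E y" for x y
    using that assms(2) by (auto simp: E_def vec_eq_iff)
  define F where "F = (\<lambda>(x, y). E x - E y) ` (S \<times> S) - {0}"
  obtain s where s: "\<And>a. a \<in> F \<Longrightarrow> a \<bullet> s \<noteq> 0"
    using exists_nonorthogonal[of F UNIV] assms(1) by (auto simp: F_def)
  have "inj_on (\<lambda>x. E x \<bullet> s) S"
  proof (rule inj_onI, rule ccontr)
    fix x y assume "x \<in> S" "y \<in> S" "E x \<bullet> s = E y \<bullet> s" "x \<noteq> y"
    then have "E x - E y \<in> F" using E_inj by (force simp: F_def)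
    from s[OF this] show False
      using \<open>E x \<bullet> s = E y \<bullet> s\<close> by (simp add: inner_diff_left)
  qed
  moreover have "(\<lambda>x. E x \<bullet> s) \<in> exp_poly r 1"
  proof -
    have "(\<lambda>x. \<Sum>i\<in>UNIV. s $ i * exp_monomial r (\<lambda>j. if j = i then 1 else 0) x) \<in> exp_poly r 1"
      by (intro exp_poly_sum exp_poly.monom) auto
    moreover have "exp_monomial r (\<lambda>j. if j = i then 1 else 0) x = exp (r * x $ i)" for i and x :: "real ^ 'n"
    proof -
      have "(\<Sum>j\<in>UNIV. real (if j = i then 1 else 0) * x $ j) = (\<Sum>j\<in>UNIV. if j = i then x $ j else 0)"
        by (intro sum.cong) auto
      then show ?thesis by (simp add: exp_monomial_def)
    qed
    ultimately show ?thesis by (simp add: E_def inner_vec_def mult.commute)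
  qed
  ultimately show ?thesis by blast
qed

lemma exp_poly_monomial_fun:
  fixes P :: "real ^ 'n \<Rightarrow> real ^ 'n"
  assumes "\<And>i. (\<lambda>x. P x $ i) \<in> exp_poly r D"
  shows "(\<lambda>x. monomial_fun \<alpha> (P x)) \<in> exp_poly r (D * sum \<alpha> UNIV)"
  unfolding monomial_fun_def sum_distrib_left
  by (intro exp_poly_prod exp_poly_power assms) auto

text \<open>A product \<open>P^\<alpha> h^j\<close> has degree at most \<open>D * m + e\<close> in
  each variable, and there are more such products than monomials of that degree. The relation is
  sorted by powers of \<open>h\<close>, to be read as a polynomial in \<open>h\<close> with
  coefficients depending on the value of \<open>P\<close>.\<close>

lemma exp_poly_algebraic_relation:
  fixes P :: "real ^ 'n \<Rightarrow> real ^ 'n"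
  assumes P: "\<And>i. (\<lambda>x. P x $ i) \<in> exp_poly r D" and h: "h \<in> exp_poly r 1"
    and e: "e = fact CARD('n) * D ^ CARD('n)"
  shows "\<exists>A l. finite A \<and> (\<exists>\<alpha>\<in>A. \<exists>j\<le>e. l \<alpha> j \<noteq> 0) \<and>
    (\<forall>x. (\<Sum>j\<le>e. (\<Sum>\<alpha>\<in>A. l \<alpha> j * monomial_fun \<alpha> (P x)) * h x ^ j) = 0)"
proof -
  obtain m where m: "(D * m + e + 1) ^ CARD('n) < ((m + CARD('n)) choose CARD('n)) * (e + 1)"
    using exists_large_degree[OF e] by blast
  define A where "A = {\<alpha> :: 'n \<Rightarrow> nat. sum \<alpha> UNIV \<le> m}"
  have A: "finite A" unfolding A_def by (rule finite_degree_le)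
  have "(D * m + e + 1) ^ CARD('n) < card (A \<times> {..e})"
    using m card_degree_le[where 'n = 'n, of m] mult_right_mono[of _ "card A" "e + 1"]
    by (fastforce simp: A_def card_cartesian_product intro: less_le_trans)
  moreover have "(\<lambda>x. monomial_fun (fst p) (P x) * h x ^ snd p) \<in> exp_poly r (D * m + e)"
    if "p \<in> A \<times> {..e}" for p
  proof (rule exp_poly_mono)
    show "(\<lambda>x. monomial_fun (fst p) (P x) * h x ^ snd p) \<in> exp_poly r (D * sum (fst p) UNIV + 1 * snd p)"
      by (intro exp_poly_mult exp_poly_monomial_fun P exp_poly_power h)
    show "D * sum (fst p) UNIV + 1 * snd p \<le> D * m + e"
      using that by (auto simp: A_def intro!: add_mono)
  qed
  ultimately obtain l where l: "\<exists>p\<in>A \<times> {..e}. l p \<noteq> 0"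
    "\<And>x. (\<Sum>p\<in>A \<times> {..e}. l p * (monomial_fun (fst p) (P x) * h x ^ snd p)) = 0"
    using exp_poly_linear_dependence[of "A \<times> {..e}" "D * m + e"
        "\<lambda>p x. monomial_fun (fst p) (P x) * h x ^ snd p" r] A by (auto simp del: mem_Sigma_iff)
  have "(\<Sum>j\<le>e. (\<Sum>\<alpha>\<in>A. l (\<alpha>, j) * monomial_fun \<alpha> (P x)) * h x ^ j) = 0" for x
    using l(2)[of x] by (subst (asm) sum.cartesian_product', subst (asm) sum.swap)
      (simp add: sum_distrib_right mult.assoc)
  with l(1) A show ?thesis
    by (intro exI[of _ A] exI[of _ "\<lambda>\<alpha> j. l (\<alpha>, j)"]) auto
qed

section \<open>A bound for the number of nondegenerate zeros\<close>

text \<open>At the value 0 of \<open>P\<close> all coefficients of the relation may vanish. The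
  zeros are therefore moved to solutions of \<open>P = c\<close> for a small \<open>c\<close> at
  which one coefficient survives, while \<open>h\<close> still tells them apart.\<close>

lemma card_nondegenerate_zeros_le:
  fixes P :: "real ^ 'n \<Rightarrow> real ^ 'n"
  assumes r: "r \<noteq> 0" and P: "\<And>i. (\<lambda>x. P x $ i) \<in> exp_poly r D"
    and S: "finite S"
    and zero: "\<And>x. x \<in> S \<Longrightarrow> P x = 0"
    and deriv: "\<And>x. x \<in> S \<Longrightarrow> \<exists>P'. (P has_derivative P') (at x) \<and> surj P'"
  shows "card S \<le> fact CARD('n) * D ^ CARD('n)"
proof -
  define e :: nat where "e = fact CARD('n) * D ^ CARD('n)"
  obtain h where h: "h \<in> exp_poly r 1" "inj_on h S"
    using exp_poly_separating[OF S r] by blast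
  obtain A l where A: "finite A" "\<exists>\<alpha>\<in>A. \<exists>j\<le>e. l \<alpha> j \<noteq> 0"
    and rel: "\<And>x. (\<Sum>j\<le>e. (\<Sum>\<alpha>\<in>A. l \<alpha> j * monomial_fun \<alpha> (P x)) * h x ^ j) = 0"
    using exp_poly_algebraic_relation[OF P h(1) e_def] by blast
  have contP: "continuous_on UNIV P"
    using continuous_on_vec_lambda[of UNIV "\<lambda>i x. P x $ i"] exp_poly_continuous[OF P] by simp
  have conth: "continuous_on UNIV h" using h(1) by (rule exp_poly_continuous)
  obtain \<delta> where \<delta>: "\<delta> > 0" "\<And>s t. s \<in> S \<Longrightarrow> t \<in> S \<Longrightarrow> s \<noteq> t \<Longrightarrow> \<delta> \<le> \<bar>h s - h t\<bar>"
  proof -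
    define Q where "Q = (\<lambda>(s, t). \<bar>h s - h t\<bar>) ` (S \<times> S) - {0}"
    \<comment> \<open>The 1 keeps the minimum defined when \<open>S\<close> has fewer than two
      points.\<close>
    have "finite (insert 1 Q)" using S by (auto simp: Q_def)
    moreover have "\<forall>q\<in>insert 1 Q. q > 0" by (auto simp: Q_def)
    ultimately have "Min (insert 1 Q) > 0" by (subst Min_gr_iff) auto
    moreover have "Min (insert 1 Q) \<le> \<bar>h s - h t\<bar>" if "s \<in> S" "t \<in> S" "s \<noteq> t" for s t
      using that h(2) \<open>finite (insert 1 Q)\<close> by (intro Min_le) (auto simp: Q_def inj_on_def)
    ultimately show ?thesis using that by blast
  qed
  \<comment> \<open>Half the minimal gap: \<open>h\<close> takes disjoint sets of values on the
    neighbourhoods of different zeros.\<close>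
  define U where "U = (\<lambda>s. {x. \<bar>h x - h s\<bar> < \<delta> / 2})"
  have U_open: "open (U s)" for s
    unfolding U_def by (intro open_Collect_less continuous_intros conth)
  have U_mem: "s \<in> U s" for s using \<delta>(1) by (simp add: U_def)
  have "\<exists>\<epsilon>>0. \<forall>c. norm c < \<epsilon> \<longrightarrow> c \<in> P ` U s" if s: "s \<in> S" for s
  proof -
    obtain P' where P': "(P has_derivative P') (at s)" "surj P'" using deriv s by blast
    obtain g where g: "linear g" "P' \<circ> g = id"
      using linear_surjective_right_inverse[OF has_derivative_linear[OF P'(1)] P'(2)] by blast
    \<comment> \<open>Open mapping at a point: a continuous map whose derivative at \<open>s\<close>
      has a linear right inverse sends neighbourhoods of \<open>s\<close> to neighbourhoods of
      \<open>P s = 0\<close>.\<close>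
    have "P s \<in> interior (P ` U s)"
      using sussmann_open_mapping[OF open_UNIV contP UNIV_I P'(1) linear_conv_bounded_linear[THEN iffD1, OF g(1)] g(2), of "U s"]
        U_open U_mem by (simp add: interior_open)
    then show ?thesis unfolding zero[OF s] mem_interior by (auto simp: subset_iff)
  qed
  then have "\<forall>s\<in>S. \<exists>\<epsilon>>0. \<forall>c. norm c < \<epsilon> \<longrightarrow> c \<in> P ` U s" by blast
  from bchoice[OF this] obtain \<epsilon> where \<epsilon>: "\<And>s. s \<in> S \<Longrightarrow> \<epsilon> s > 0"
    "\<And>s c. s \<in> S \<Longrightarrow> norm c < \<epsilon> s \<Longrightarrow> c \<in> P ` U s" by blast
  define \<rho> where "\<rho> = Min (insert 1 (\<epsilon> ` S))"
  have \<rho>: "\<rho> > 0" "\<And>s. s \<in> S \<Longrightarrow> \<rho> \<le> \<epsilon> s"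
    unfolding \<rho>_def using S \<epsilon>(1) by (auto simp: Min_gr_iff)
  obtain \<alpha> j0 where l0: "\<alpha> \<in> A" "j0 \<le> e" "l \<alpha> j0 \<noteq> 0" using A(2) by blast
  \<comment> \<open>The coefficient of \<open>h ^ j0\<close> is a nonzero polynomial in
    \<open>c\<close>, hence it does not vanish on the whole ball of radius
    \<open>\<rho>\<close>.\<close>
  obtain c where c: "norm c < \<rho>" "(\<Sum>\<alpha>\<in>A. l \<alpha> j0 * monomial_fun \<alpha> c) \<noteq> 0"
    using monomial_funs_independent_ball[OF A(1) \<rho>(1), of "\<lambda>\<alpha>. l \<alpha> j0" \<alpha>] l0 by blast
  define R where "R = {t. (\<Sum>j\<le>e. (\<Sum>\<alpha>\<in>A. l \<alpha> j * monomial_fun \<alpha> c) * t ^ j) = 0}"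
  have R: "finite R" "card R \<le> e"
    using Transcendental.polyfun_rootbound[of "\<lambda>j. \<Sum>\<alpha>\<in>A. l \<alpha> j * monomial_fun \<alpha> c" j0 e] c(2) l0(2)
    by (auto simp: R_def)
  have "\<exists>y. y \<in> U s \<and> P y = c" if "s \<in> S" for s
    using \<epsilon>(2)[OF that, of c] \<rho>(2)[OF that] c(1) by auto
  then have "\<forall>s\<in>S. \<exists>y. y \<in> U s \<and> P y = c" by blast
  from bchoice[OF this] obtain y where
    y: "\<And>s. s \<in> S \<Longrightarrow> y s \<in> U s" "\<And>s. s \<in> S \<Longrightarrow> P (y s) = c" by blast
  have "inj_on (\<lambda>s. h (y s)) S"
  proof (rule inj_onI, rule ccontr)
    fix s t assume st: "s \<in> S" "t \<in> S" "h (y s) = h (y t)" "s \<noteq> t"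
    then have "\<delta> \<le> \<bar>h s - h t\<bar>" "\<bar>h (y s) - h s\<bar> < \<delta> / 2" "\<bar>h (y t) - h t\<bar> < \<delta> / 2"
      using \<delta>(2)[OF st(1,2,4)] y(1)[OF st(1)] y(1)[OF st(2)] by (simp_all add: U_def)
    then show False using st(3) by linarith
  qed
  moreover have "(\<lambda>s. h (y s)) ` S \<subseteq> R"
  proof clarify
    fix s assume "s \<in> S"
    then show "h (y s) \<in> R" using rel[of "y s"] y(2) by (simp add: R_def)
  qed
  ultimately have "card S \<le> card R" using R(1) card_inj_on_le by blast
  then show ?thesis using R(2) by (simp add: e_def)
qed

section \<open>Smooth curves and tangent spaces\<close>

lemma Ck_on_cong:
  assumes "open S" "\<And>x. x \<in> S \<Longrightarrow> f x = g x" "Ck_on k f S"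
  shows "Ck_on k g S"
  using assms(2,3)
proof (induction k arbitrary: f g)
  case 0
  then show ?case by (metis Ck_on.simps(1) continuous_on_cong)
next
  case (Suc k)
  have f: "f differentiable (at x)" if "x \<in> S" for x using Suc.prems(2) that by simp
  have "g differentiable (at x)" if x: "x \<in> S" for x
  proof -
    obtain f' where "(f has_derivative f') (at x)" using f[OF x] unfolding differentiable_def by blast
    from has_derivative_transform_within_open[OF this assms(1) x Suc.prems(1)] show ?thesis
      unfolding differentiable_def by blast
  qed
  moreover have "Ck_on k (\<lambda>x. frechet_derivative g (at x) v) S" for v
  proof (rule Suc.IH)
    show "Ck_on k (\<lambda>x. frechet_derivative f (at x) v) S" using Suc.prems(2) by simp
    show "frechet_derivative f (at x) v = frechet_derivative g (at x) v" if "x \<in> S" for x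
      using frechet_derivative_transform_within_open[OF f[OF that] assms(1) that Suc.prems(1)] by simp
  qed
  ultimately show ?case by simp
qed

text \<open>The derivative along a line is again a function on the line, namely a directional
  derivative of \<open>F\<close>; so the induction runs over all \<open>F\<close>. Lines in the
  slice of a chart are the only curves that will be composed with a chart map.\<close>

lemma Ck_on_line:
  fixes F :: "'a::real_normed_vector \<Rightarrow> 'b::real_normed_vector"
  assumes "open T" "\<And>t. t \<in> T \<Longrightarrow> y + t *\<^sub>R h \<in> W" "Ck_on k F W"
  shows "Ck_on k (\<lambda>t. F (y + t *\<^sub>R h)) T"
  using assms(3)
proof (induction k arbitrary: F)
  case 0
  then show ?case
    using assms(2) by (auto intro!: continuous_on_compose2[of W F] continuous_intros)
next
  case (Suc k)
  have der: "((\<lambda>t. F (y + t *\<^sub>R h)) has_derivative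
      (\<lambda>s. frechet_derivative F (at (y + t *\<^sub>R h)) (s *\<^sub>R h))) (at t)" if "t \<in> T" for t
  proof (rule has_derivative_compose[of "\<lambda>t. y + t *\<^sub>R h" "\<lambda>s. s *\<^sub>R h" t UNIV F])
    show "((\<lambda>t. y + t *\<^sub>R h) has_derivative (\<lambda>s. s *\<^sub>R h)) (at t)"
      by (auto intro!: derivative_eq_intros)
    show "(F has_derivative frechet_derivative F (at (y + t *\<^sub>R h))) (at (y + t *\<^sub>R h))"
      using Suc.prems assms(2)[OF that] frechet_derivative_works by auto
  qed
  have "Ck_on k (\<lambda>t. frechet_derivative (\<lambda>t. F (y + t *\<^sub>R h)) (at t) s) T" for s
  proof (rule Ck_on_cong[OF assms(1)])
    show "Ck_on k (\<lambda>t. frechet_derivative F (at (y + t *\<^sub>R h)) (s *\<^sub>R h)) T"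
      using Suc.IH[of "\<lambda>x. frechet_derivative F (at x) (s *\<^sub>R h)"] Suc.prems by simp
  qed (simp add: frechet_derivative_at[OF der, symmetric])
  moreover have "(\<lambda>t. F (y + t *\<^sub>R h)) differentiable (at t)" if "t \<in> T" for t
    using der[OF that] unfolding differentiable_def by blast
  ultimately show ?case by simp
qed

text \<open>With \<open>a\<close> and \<open>b\<close> arbitrary, the family is closed under
  differentiation, which closes the induction.\<close>

lemma Ck_on_cos_sin: "Ck_on k (\<lambda>t. cos t *\<^sub>R a + sin t *\<^sub>R b) S"
  for a b :: "'a::real_normed_vector"
proof (induction k arbitrary: a b)
  case 0
  then show ?case by (auto intro!: continuous_intros)
next
  case (Suc k)
  have der: "((\<lambda>t. cos t *\<^sub>R a + sin t *\<^sub>R b) has_derivative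
      (\<lambda>s. cos t *\<^sub>R (s *\<^sub>R b) + sin t *\<^sub>R (- s *\<^sub>R a))) (at t)" for t
    by (auto intro!: derivative_eq_intros simp: mult.commute)
  have "(\<lambda>t. cos t *\<^sub>R a + sin t *\<^sub>R b) differentiable (at t)" for t
    using der unfolding differentiable_def by blast
  moreover have "Ck_on k (\<lambda>t. cos t *\<^sub>R (s *\<^sub>R b) + sin t *\<^sub>R (- s *\<^sub>R a)) S" for s
    by (rule Suc.IH)
  ultimately show ?case by (simp only: Ck_on.simps frechet_derivative_at[OF der, symmetric]) blast
qed

text \<open>The curve is the great circle through \<open>v\<close> with velocity
  \<open>\<tau>\<close>; unit length of \<open>\<tau>\<close> keeps it on the sphere.\<close>

lemma unit_orthogonal_in_tangent_space_sphere:
  fixes v :: "'a::euclidean_space"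
  assumes "norm v = 1" "norm \<tau> = 1" "v \<bullet> \<tau> = 0"
  shows "\<tau> \<in> tangent_space (sphere 0 1) v"
proof -
  define c where "c = (\<lambda>t. cos t *\<^sub>R v + sin t *\<^sub>R \<tau>)"
  have "norm (c t) = 1" for t
  proof -
    have "c t \<bullet> c t = (cos t)\<^sup>2 * (v \<bullet> v) + (sin t)\<^sup>2 * (\<tau> \<bullet> \<tau>)"
      using assms(3) by (simp add: c_def inner_add inner_commute power2_eq_square)
    then show ?thesis using assms(1,2) by (simp add: norm_eq_1)
  qed
  moreover have "(c has_vector_derivative \<tau>) (at 0)"
    unfolding c_def by (auto intro!: derivative_eq_intros)
  moreover have "smooth_on c {-1<..<1}" by (simp add: c_def smooth_on_def Ck_on_cos_sin)
  ultimately show ?thesis unfolding tangent_space_def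
    by (intro CollectI exI[of _ c] exI[of _ 1]) (auto simp: c_def)
qed

text \<open>Along a curve in \<open>M\<close> the function \<open>f\<close> is constantly 0, so the
  chain rule gives the claim.\<close>

lemma tangent_space_annihilated:
  assumes "t \<in> tangent_space M x" "(f has_derivative f') (at x)" "\<And>y. y \<in> M \<Longrightarrow> f y = 0"
  shows "f' t = 0"
proof -
  obtain c \<epsilon> where c: "\<epsilon> > 0" "c ` {-\<epsilon><..<\<epsilon>} \<subseteq> M" "c 0 = x" "(c has_vector_derivative t) (at (0::real))"
    using assms(1) by (auto simp: tangent_space_def)
  have "((\<lambda>s. f (c s)) has_derivative (\<lambda>s. f' (s *\<^sub>R t))) (at 0)"
    using c(3) assms(2) has_derivative_compose[OF c(4)[unfolded has_vector_derivative_def], of f f']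
    by simp
  moreover have "((\<lambda>s. f (c s)) has_derivative (\<lambda>_. 0)) (at 0)"
    using c(1,2) assms(3) has_derivative_transform_within_open[of "\<lambda>_. 0" "\<lambda>_. 0" 0 UNIV "{-\<epsilon><..<\<epsilon>}" "\<lambda>s. f (c s)"]
    by (simp add: image_subset_iff)
  ultimately have "(\<lambda>s. f' (s *\<^sub>R t)) = (\<lambda>_. 0)" by (rule has_derivative_unique)
  from fun_cong[OF this, of 1] show ?thesis by simp
qed

lemma tangent_space_contains_subspace:
  fixes M :: "'a::euclidean_space set"
  assumes "smooth_submanifold d M" "x \<in> M"
  shows "\<exists>K. subspace K \<and> dim K = d \<and> K \<subseteq> tangent_space M x"
proof -
  obtain U W \<phi> \<psi> and H :: "'a set" where
    U: "open U" "x \<in> U" and W: "open W" and hom: "homeomorphism U W \<phi> \<psi>"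
    and \<phi>: "smooth_on \<phi> U" and \<psi>: "smooth_on \<psi> W"
    and H: "subspace H" "dim H = d" and eq: "\<phi> ` (M \<inter> U) = W \<inter> H"
    using bspec[OF assms(1)[unfolded smooth_submanifold_def] assms(2)] by (elim exE conjE)
  define y where "y = \<phi> x"
  have y: "y \<in> W \<inter> H" using eq assms(2) U(2) unfolding y_def by blast
  have \<psi>y: "\<psi> y = x" using hom U(2) by (simp add: y_def homeomorphism_def)
  have "Ck_on (Suc 0) \<phi> U" "Ck_on (Suc 0) \<psi> W" using \<phi> \<psi> unfolding smooth_on_def by blast+
  then obtain \<phi>' \<psi>' where der: "(\<phi> has_derivative \<phi>') (at x)" "(\<psi> has_derivative \<psi>') (at y)"
    using U(2) y unfolding Ck_on.simps differentiable_def by blast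
  have "((\<lambda>z. \<phi> (\<psi> z)) has_derivative (\<lambda>z. \<phi>' (\<psi>' z))) (at y)"
    using has_derivative_compose[OF der(2)] der(1) \<psi>y by simp
  moreover have "((\<lambda>z. \<phi> (\<psi> z)) has_derivative (\<lambda>z. z)) (at y)"
    by (rule has_derivative_transform_within_open[OF has_derivative_ident W])
      (use y hom in \<open>auto simp: homeomorphism_def\<close>)
  ultimately have "(\<lambda>z. \<phi>' (\<psi>' z)) = (\<lambda>z. z)" by (rule has_derivative_unique)
  then have inj: "inj \<psi>'" by (metis injI)
  have lin: "linear \<psi>'" using der(2) by (rule has_derivative_linear)
  have "\<psi>' h \<in> tangent_space M x" if h: "h \<in> H" for h
  proof -
    define c where "c = (\<lambda>t. \<psi> (y + t *\<^sub>R h))"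
    have "open ((\<lambda>t. y + t *\<^sub>R h) -` W)"
      by (intro open_vimage[OF W] continuous_intros)
    then obtain \<epsilon> where \<epsilon>: "\<epsilon> > 0" "ball 0 \<epsilon> \<subseteq> (\<lambda>t. y + t *\<^sub>R h) -` W"
      using y by (force simp: open_contains_ball)
    have ball: "ball 0 \<epsilon> = {-\<epsilon><..<\<epsilon>}" by (auto simp: dist_real_def)
    have line: "y + t *\<^sub>R h \<in> W \<inter> H" if "t \<in> {-\<epsilon><..<\<epsilon>}" for t
      using \<epsilon>(2) that y h H(1) unfolding ball by (auto intro: subspace_add subspace_scale)
    have "smooth_on c {-\<epsilon><..<\<epsilon>}"
      using \<psi> line unfolding smooth_on_def c_def by (auto intro!: Ck_on_line[of _ _ _ W])
    moreover have "c ` {-\<epsilon><..<\<epsilon>} \<subseteq> M"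
    proof clarify
      fix t assume "t \<in> {-\<epsilon><..<\<epsilon>}"
      from line[OF this] obtain z where z: "z \<in> M \<inter> U" "y + t *\<^sub>R h = \<phi> z" using eq by blast
      then have "c t = z" using hom by (simp add: c_def homeomorphism_def)
      then show "c t \<in> M" using z by blast
    qed
    moreover have "(c has_vector_derivative \<psi>' h) (at 0)"
    proof -
      have "((\<lambda>t. y + t *\<^sub>R h) has_derivative (\<lambda>s. s *\<^sub>R h)) (at 0)"
        by (auto intro!: derivative_eq_intros)
      from has_derivative_compose[OF this, of \<psi> \<psi>'] der(2) show ?thesis
        by (simp add: has_vector_derivative_def c_def linear_scale[OF lin])
    qed
    ultimately show ?thesis using \<epsilon>(1) \<psi>y unfolding tangent_space_def
      by (intro CollectI exI[of _ c] exI[of _ \<epsilon>]) (auto simp: c_def)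
  qed
  then have "\<psi>' ` H \<subseteq> tangent_space M x" by blast
  moreover have "subspace (\<psi>' ` H)" using lin H(1) by (rule linear_subspace_image)
  moreover have "dim (\<psi>' ` H) = d" using dim_image_eq[OF lin, of H] inj H(2) by (simp add: inj_on_subset)
  ultimately show ?thesis by blast
qed

text \<open>The tangent space contains a subspace of codimension 1 which lies in the hyperplane
  orthogonal to \<open>G\<close>, hence equals it by dimension. A vector orthogonal to that
  hyperplane is a multiple of \<open>G\<close>.\<close>

lemma gradient_parallel_unit_normal:
  fixes V :: "'a::euclidean_space set"
  assumes V: "smooth_hypersurface V" "x \<in> V" "\<And>y. y \<in> V \<Longrightarrow> f y = 0"
    and G: "(f has_derivative (\<lambda>h. h \<bullet> G)) (at x)" "G \<noteq> 0"
    and u: "norm u = 1" "\<forall>t\<in>tangent_space V x. orthogonal u t"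
  shows "G = (G \<bullet> u) *\<^sub>R u"
proof -
  obtain K where K: "subspace K" "dim K = DIM('a) - 1" "K \<subseteq> tangent_space V x"
    using tangent_space_contains_subspace V(1,2) unfolding smooth_hypersurface_def by blast
  have "K \<subseteq> {y. G \<bullet> y = 0}"
    using K(3) tangent_space_annihilated[OF _ G(1) V(3)] by (auto simp: inner_commute)
  then have KG: "K = {y. G \<bullet> y = 0}"
    using K(1,2) G(2) by (intro subspace_dim_equal) (auto simp: subspace_hyperplane dim_hyperplane)
  \<comment> \<open>The component of \<open>u\<close> orthogonal to \<open>G\<close> is a tangent
    vector. It is orthogonal to \<open>u\<close> and to \<open>G\<close>, hence to itself.\<close>
  define w where "w = u - (G \<bullet> u / (G \<bullet> G)) *\<^sub>R G"
  have Gw: "G \<bullet> w = 0" using G(2) by (simp add: w_def inner_diff_right)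
  then have "u \<bullet> w = 0" using u(2) K(3) KG by (auto simp: orthogonal_def)
  then have "w \<bullet> w = 0" using Gw unfolding w_def by (simp add: inner_diff_left)
  then have eq: "u = (G \<bullet> u / (G \<bullet> G)) *\<^sub>R G" by (simp add: w_def)
  define \<kappa> where "\<kappa> = G \<bullet> u / (G \<bullet> G)"
  have u\<kappa>: "u = \<kappa> *\<^sub>R G" using eq by (simp add: \<kappa>_def)
  have "\<kappa>\<^sup>2 * (G \<bullet> G) = 1" using u(1) unfolding norm_eq_1 u\<kappa> by (simp add: power2_eq_square)
  then have "(G \<bullet> u) * \<kappa> = 1" unfolding u\<kappa> by (simp add: power2_eq_square mult_ac)
  then have "((G \<bullet> u) * \<kappa>) *\<^sub>R G = G" by simp
  then show ?thesis unfolding u\<kappa> by simp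
qed

section \<open>Regular values of the Gauss map\<close>

text \<open>Along a curve \<open>(x(t), u(t))\<close> in the bundle, \<open>f\<close> vanishes and
  \<open>G = (G \<bullet> u) u\<close>, so the bracket in \<open>P\<close> is
  \<open>G \<bullet> u\<close> times the projection of \<open>u\<close>. Regularity provides such
  curves with \<open>u' = \<tau>\<close> for every unit \<tau> orthogonal to \<open>v\<close>, and
  these directions are reached by the derivative; the direction \<open>v\<close> is reached through
  \<open>f\<close>. The factor \<open>g\<close> is there to clear denominators: at a zero of the
  bracket it only rescales the derivative.\<close>

lemma regular_value_imp_surj_derivative:
  fixes f g :: "'a::euclidean_space \<Rightarrow> real" and G :: "'a \<Rightarrow> 'a"
  assumes f: "\<And>y. (f has_derivative (\<lambda>h. h \<bullet> G y)) (at y)"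
    and G: "(G has_derivative G') (at x)"
    and g: "(g has_derivative g') (at x)" "g x \<noteq> 0"
    and V: "V = {y. f y = 0}" "smooth_hypersurface V" "\<And>y. y \<in> V \<Longrightarrow> G y \<noteq> 0"
    and v: "regular_value gauss_map (normal_sphere_bundle V) (sphere 0 1) v"
      "(x, v) \<in> normal_sphere_bundle V"
  defines "P \<equiv> \<lambda>y. g y *\<^sub>R (f y *\<^sub>R v + (G y - (G y \<bullet> v) *\<^sub>R v))"
  shows "P x = 0" "\<exists>P'. (P has_derivative P') (at x) \<and> surj P'"
proof -
  have normal: "G y = (G y \<bullet> u) *\<^sub>R u" if "(y, u) \<in> normal_sphere_bundle V" for y u
    using that f V by (intro gradient_parallel_unit_normal[of V y f]) (auto simp: normal_sphere_bundle_def)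
  define Q where "Q = (\<lambda>y. f y *\<^sub>R v + (G y - (G y \<bullet> v) *\<^sub>R v))"
  define Q' where "Q' = (\<lambda>h. (h \<bullet> G x) *\<^sub>R v + (G' h - (G' h \<bullet> v) *\<^sub>R v))"
  have PQ: "P = (\<lambda>y. g y *\<^sub>R Q y)" by (simp add: P_def Q_def)
  have xV: "x \<in> V" and nv: "norm v = 1" using v(2) by (auto simp: normal_sphere_bundle_def)
  have vv: "v \<bullet> v = 1" using nv by (simp add: norm_eq_1)
  define \<mu> where "\<mu> = G x \<bullet> v"
  have Gx: "G x = \<mu> *\<^sub>R v" using normal[OF v(2)] by (simp add: \<mu>_def)
  then have \<mu>0: "\<mu> \<noteq> 0" using V(3)[OF xV] by auto
  have Qx: "Q x = 0" using xV V(1) Gx vv by (simp add: Q_def)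
  then show "P x = 0" by (simp add: PQ)
  have Q': "(Q has_derivative Q') (at x)"
    unfolding Q_def Q'_def by (rule derivative_eq_intros f G refl)+ (auto simp: fun_eq_iff)
  have P': "(P has_derivative (\<lambda>h. g x *\<^sub>R Q' h)) (at x)"
    unfolding PQ by (rule derivative_eq_intros Q' g(1) refl)+ (auto simp: fun_eq_iff Qx)
  have lin: "linear Q'" using Q' by (rule has_derivative_linear)
  then have sub: "subspace (range Q')" by (rule linear_subspace_image) simp
  have unit: "\<tau> \<in> range Q'" if \<tau>: "norm \<tau> = 1" "v \<bullet> \<tau> = 0" for \<tau>
  proof -
    have gm: "frechet_derivative gauss_map (at p) = snd" for p :: "'a \<times> 'a"
    proof -
      have "(gauss_map has_derivative snd) (at p)"
        unfolding gauss_map_def case_prod_beta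
        by (rule bounded_linear_imp_has_derivative[OF bounded_linear_snd])
      then show ?thesis by (rule frechet_derivative_at[symmetric])
    qed
    \<comment> \<open>Here regularity enters: \<tau> is tangent to the sphere at \<open>v\<close>,
      so it lifts to a tangent vector of the bundle.\<close>
    have "\<tau> \<in> frechet_derivative gauss_map (at (x, v)) ` tangent_space (normal_sphere_bundle V) (x, v)"
      using v unit_orthogonal_in_tangent_space_sphere[OF nv \<tau>]
      unfolding regular_value_def by (auto simp: gauss_map_def)
    then obtain \<xi> where "(\<xi>, \<tau>) \<in> tangent_space (normal_sphere_bundle V) (x, v)"
      unfolding gm by force
    then obtain c \<epsilon> where c: "\<epsilon> > 0" "c ` {-\<epsilon><..<\<epsilon>} \<subseteq> normal_sphere_bundle V" "c 0 = (x, v)"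
      "(c has_vector_derivative (\<xi>, \<tau>)) (at (0::real))"
      by (auto simp: tangent_space_def)
    have X: "((\<lambda>t. fst (c t)) has_derivative (\<lambda>s. s *\<^sub>R \<xi>)) (at 0)"
      using has_derivative_fst[OF c(4)[unfolded has_vector_derivative_def]] by simp
    have U: "((\<lambda>t. snd (c t)) has_derivative (\<lambda>s. s *\<^sub>R \<tau>)) (at 0)"
      using has_derivative_snd[OF c(4)[unfolded has_vector_derivative_def]] by simp
    have GX: "((\<lambda>t. G (fst (c t))) has_derivative (\<lambda>s. G' (s *\<^sub>R \<xi>))) (at 0)"
      using has_derivative_compose[OF X, of G G'] G c(3) by simp
    have QX: "((\<lambda>t. Q (fst (c t))) has_derivative (\<lambda>s. Q' (s *\<^sub>R \<xi>))) (at 0)"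
      using has_derivative_compose[OF X, of Q Q'] Q' c(3) by simp
    \<comment> \<open>The second factor vanishes at 0 because \<open>u(0) = v\<close>, so the
      product rule leaves only \<open>\<mu>\<close> times the projection of \<tau>, which is \<tau>
      itself.\<close>
    define R where "R = (\<lambda>t. (G (fst (c t)) \<bullet> snd (c t)) *\<^sub>R (snd (c t) - (snd (c t) \<bullet> v) *\<^sub>R v))"
    have "(R has_derivative (\<lambda>s. s *\<^sub>R \<mu> *\<^sub>R \<tau>)) (at 0)"
      unfolding R_def
      by (rule derivative_eq_intros GX U refl)+
        (use \<tau>(2) vv c(3) in \<open>auto simp: fun_eq_iff \<mu>_def inner_commute algebra_simps\<close>)
    moreover have "R t = Q (fst (c t))" if "t \<in> {-\<epsilon><..<\<epsilon>}" for t
    proof -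
      have mem: "(fst (c t), snd (c t)) \<in> normal_sphere_bundle V" using c(2) that by auto
      then have "f (fst (c t)) = 0" using V(1) by (auto simp: normal_sphere_bundle_def)
      moreover have "G (fst (c t)) - (G (fst (c t)) \<bullet> v) *\<^sub>R v = R t"
        unfolding R_def
        by (subst (1 2) normal[OF mem]) (simp add: scaleR_right_diff_distrib)
      ultimately show ?thesis by (simp add: Q_def)
    qed
    ultimately have "((\<lambda>t. Q (fst (c t))) has_derivative (\<lambda>s. s *\<^sub>R \<mu> *\<^sub>R \<tau>)) (at 0)"
      using c(1) has_derivative_transform_within_open[of R _ 0 UNIV "{-\<epsilon><..<\<epsilon>}"] by simp
    from fun_cong[OF has_derivative_unique[OF this QX], of 1] have "\<mu> *\<^sub>R \<tau> \<in> range Q'"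
      by simp
    then have "(1 / \<mu>) *\<^sub>R \<mu> *\<^sub>R \<tau> \<in> range Q'" by (rule subspace_scale[OF sub])
    then show ?thesis using \<mu>0 by simp
  qed
  have perp: "w \<in> range Q'" if w: "v \<bullet> w = 0" for w
  proof (cases "w = 0")
    case False
    then have "(1 / norm w) *\<^sub>R w \<in> range Q'" using w by (intro unit) auto
    then have "norm w *\<^sub>R (1 / norm w) *\<^sub>R w \<in> range Q'" by (rule subspace_scale[OF sub])
    then show ?thesis using False by simp
  qed (use subspace_0[OF sub] in simp)
  have "v \<in> range Q'"
  proof -
    \<comment> \<open>Modulo vectors orthogonal to \<open>v\<close>, already known to be in the
      range, \<open>Q' v\<close> is \<open>\<mu> v\<close> with nonzero
      \<open>\<mu>\<close>.\<close>
    have "Q' v = \<mu> *\<^sub>R v + (G' v - (G' v \<bullet> v) *\<^sub>R v)" by (simp add: Q'_def \<mu>_def inner_commute)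
    moreover have "G' v - (G' v \<bullet> v) *\<^sub>R v \<in> range Q'"
      using vv by (intro perp) (simp add: inner_diff_right inner_commute)
    ultimately have "\<mu> *\<^sub>R v \<in> range Q'"
      using subspace_diff[OF sub rangeI[of Q' v]] by (metis add_diff_cancel_right')
    then have "(1 / \<mu>) *\<^sub>R \<mu> *\<^sub>R v \<in> range Q'" by (rule subspace_scale[OF sub])
    then show ?thesis using \<mu>0 by simp
  qed
  have "z \<in> range Q'" for z
  proof -
    have "z - (z \<bullet> v) *\<^sub>R v \<in> range Q'" using vv by (intro perp) (simp add: inner_diff_right inner_commute)
    moreover have "(z \<bullet> v) *\<^sub>R v \<in> range Q'" using \<open>v \<in> range Q'\<close> by (rule subspace_scale[OF sub])
    ultimately show ?thesis using subspace_add[OF sub] by (metis diff_add_cancel)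
  qed
  then have "\<exists>h. z = g x *\<^sub>R Q' h" for z
    using g(2) by (metis imageE scaleR_scaleR scaleR_one right_inverse)
  then have "surj (\<lambda>h. g x *\<^sub>R Q' h)" unfolding surj_def by blast
  with P' show "\<exists>P'. (P has_derivative P') (at x) \<and> surj P'" by blast
qed

section \<open>Sums of sigmoids\<close>

lemma sigmoid_has_field_derivative:
  "(sigmoid has_field_derivative exp (- u) / (1 + exp (- u))\<^sup>2) (at u)"
proof -
  have "1 + exp (- u) \<noteq> 0" using exp_gt_zero[of "- u"] by linarith
  then show ?thesis unfolding sigmoid_def
    by (auto intro!: derivative_eq_intros simp: power2_eq_square field_simps)
qed

text \<open>The second derivative of the sigmoid serves only to differentiate the gradient of
  \<open>f\<close>; its formula never enters.\<close>

lemma sigmoid_derivative_has_field_derivative: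
  "\<exists>D. \<forall>u. ((\<lambda>u. exp (- u) / (1 + exp (- u))\<^sup>2) has_field_derivative D u) (at (u :: real))"
proof -
  have "((\<lambda>u. exp (- u) / (1 + exp (- u))\<^sup>2) has_field_derivative
      (- exp (- u) * (1 + exp (- u))\<^sup>2 - exp (- u) * (2 * (1 + exp (- u)) * - exp (- u))) /
      ((1 + exp (- u))\<^sup>2 * (1 + exp (- u))\<^sup>2)) (at u)" for u :: real
  proof (rule DERIV_divide)
    show "((\<lambda>u. exp (- u)) has_field_derivative - exp (- u)) (at u)"
      by (auto intro!: derivative_eq_intros)
    show "((\<lambda>u. (1 + exp (- u))\<^sup>2) has_field_derivative 2 * (1 + exp (- u)) * - exp (- u)) (at u)"
      by (auto intro!: derivative_eq_intros)
    have "1 + exp (- u) \<noteq> 0" using exp_gt_zero[of "- u"] by linarith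
    then show "(1 + exp (- u))\<^sup>2 \<noteq> 0" by simp
  qed
  then show ?thesis by (intro exI allI)
qed

lemma has_derivative_ridge:
  fixes a x :: "'a::real_inner"
  assumes "(s has_field_derivative D) (at (a \<bullet> x + b))"
  shows "((\<lambda>y. s (a \<bullet> y + b)) has_derivative (\<lambda>h. D * (a \<bullet> h))) (at x)"
proof -
  have "((\<lambda>y. a \<bullet> y + b) has_derivative (\<lambda>h. a \<bullet> h)) (at x)"
    by (auto intro!: derivative_eq_intros)
  from has_derivative_compose[OF this, of s "(*) D"] show ?thesis
    using assms by (simp add: has_field_derivative_def)
qed

text \<open>Points of a fibre are determined by their base points. A uniform bound for all finite
  subsets also rules out infinite fibres, where \<open>ecard\<close> would be infinite.\<close>

lemma mdeg_le:
  assumes "\<And>v S. regular_value gauss_map (normal_sphere_bundle V) (sphere 0 1) v \<Longrightarrow> finite S \<Longrightarrow>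
    (\<And>x. x \<in> S \<Longrightarrow> (x, v) \<in> normal_sphere_bundle V) \<Longrightarrow> card S \<le> N"
  shows "mdeg V \<le> enat N"
  unfolding mdeg_def
proof (rule SUP_least)
  fix v assume "v \<in> {v. regular_value gauss_map (normal_sphere_bundle V) (sphere 0 1) v}"
  then have v: "regular_value gauss_map (normal_sphere_bundle V) (sphere 0 1) v" by simp
  define Z where "Z = {p \<in> normal_sphere_bundle V. gauss_map p = v}"
  have "card F \<le> N" if F: "F \<subseteq> Z" "finite F" for F
  proof -
    have snd: "snd p = v" if "p \<in> F" for p using F(1) that by (auto simp: Z_def gauss_map_def case_prod_beta)
    have "inj_on fst F" by (rule inj_onI) (metis snd prod_eqI)
    then have "card F = card (fst ` F)" by (simp add: card_image)
    also have "\<dots> \<le> N"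
    proof (rule assms[OF v])
      fix x assume "x \<in> fst ` F"
      then obtain p where "p \<in> F" "x = fst p" by blast
      then show "(x, v) \<in> normal_sphere_bundle V" using snd[of p] F(1) by (auto simp: Z_def)
    qed (use F(2) in simp)
    finally show ?thesis .
  qed
  then have "finite Z \<and> card Z \<le> N" by (intro finite_if_finite_subsets_card_bdd) blast
  then show "ecard Z \<le> enat N" by (simp add: ecard_def)
qed

text \<open>Multiplying numerator and denominator of \<open>\<sigma> (a \<bullet> x + b)\<close> by a monomial splits the exponents into
  their positive parts \<open>p\<close> and negative parts \<open>m\<close>, so that no negative exponents occur.\<close>

lemma exp_split:
  fixes a x :: "real ^ 'n"
  assumes "r \<noteq> 0" "\<And>i. r * (real (p i) - real (m i)) = a $ i"
  shows "exp (- (a \<bullet> x + b)) = exp (- b) * exp_monomial r m x / exp_monomial r p x"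
proof -
  have "a \<bullet> x = r * (\<Sum>i\<in>UNIV. real (p i) * x $ i) - r * (\<Sum>i\<in>UNIV. real (m i) * x $ i)"
    unfolding inner_vec_def assms(2)[symmetric]
    by (simp add: sum_distrib_left sum_subtractf[symmetric] algebra_simps)
  then show ?thesis
    by (simp add: exp_monomial_def exp_add[symmetric] exp_diff[symmetric])
qed

text \<open>This is \<open>1 + exp (- (a \<bullet> x + b))\<close> multiplied by the monomial with
  exponents \<open>p\<close>, when \<open>p\<close> and \<open>m\<close> are the positive and
  negative parts of \<open>a\<close> in units of \<open>r\<close>.\<close>

definition sigmoid_denominator ::
  "real \<Rightarrow> ('n::finite \<Rightarrow> nat) \<Rightarrow> ('n \<Rightarrow> nat) \<Rightarrow> real \<Rightarrow> real ^ 'n \<Rightarrow> real" where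
  "sigmoid_denominator r p m b x = exp_monomial r p x + exp (- b) * exp_monomial r m x"

lemma exp_monomial_pos: "exp_monomial r p x > 0"
  by (simp add: exp_monomial_def)

lemma sigmoid_denominator_pos: "sigmoid_denominator r p m b x > 0"
  by (simp add: sigmoid_denominator_def exp_monomial_pos add_pos_pos)

text \<open>The second identity concerns the derivative of the sigmoid; its squared denominator is
  why squares are cleared below.\<close>

lemma sigmoid_eq:
  fixes a x :: "real ^ 'n"
  assumes "r \<noteq> 0" "\<And>i. r * (real (p i) - real (m i)) = a $ i"
  shows "sigmoid (a \<bullet> x + b) = exp_monomial r p x / sigmoid_denominator r p m b x"
    and "exp (- (a \<bullet> x + b)) / (1 + exp (- (a \<bullet> x + b)))\<^sup>2 =
      exp (- b) * exp_monomial r p x * exp_monomial r m x / (sigmoid_denominator r p m b x)\<^sup>2"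
proof -
  have pos: "exp_monomial r p x > 0" "sigmoid_denominator r p m b x > 0"
    by (rule exp_monomial_pos sigmoid_denominator_pos)+
  have eq: "1 + exp (- (a \<bullet> x + b)) = sigmoid_denominator r p m b x / exp_monomial r p x"
    unfolding exp_split[OF assms] sigmoid_denominator_def using pos(1) by (simp add: field_simps)
  show "sigmoid (a \<bullet> x + b) = exp_monomial r p x / sigmoid_denominator r p m b x"
    unfolding sigmoid_def eq by simp
  show "exp (- (a \<bullet> x + b)) / (1 + exp (- (a \<bullet> x + b)))\<^sup>2 =
      exp (- b) * exp_monomial r p x * exp_monomial r m x / (sigmoid_denominator r p m b x)\<^sup>2"
    unfolding eq unfolding exp_split[OF assms] using pos by (simp add: power2_eq_square field_simps)
qed

lemma exp_monomial_in_exp_poly: "exp_monomial r p \<in> exp_poly r D" if "\<And>i. p i \<le> D"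
  using exp_poly.monom[OF that, of 1 r] by simp

lemma sigmoid_denominator_in_exp_poly:
  assumes "\<And>i. p i \<le> D" "\<And>i. m i \<le> D"
  shows "sigmoid_denominator r p m b \<in> exp_poly r D"
  using exp_poly.add[OF exp_monomial_in_exp_poly[OF assms(1)] exp_poly.monom[OF assms(2)]]
  by (simp add: sigmoid_denominator_def[abs_def])

text \<open>In the term of index \<open>k\<close> the factor \<open>k\<close> of the product absorbs
  the denominator at degree \<open>2 * D\<close>; each of the other factors contributes another
  \<open>2 * D\<close>.\<close>

lemma exp_poly_clear_denominators:
  fixes T den :: "'k \<Rightarrow> real ^ 'n \<Rightarrow> real"
  assumes K: "finite K"
    and den: "\<And>k. k \<in> K \<Longrightarrow> den k \<in> exp_poly r D"
    and T: "\<And>k. k \<in> K \<Longrightarrow> (\<lambda>x. (den k x)\<^sup>2 * T k x) \<in> exp_poly r (2 * D)"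
  shows "(\<lambda>x. (\<Prod>k\<in>K. (den k x)\<^sup>2) * (\<Sum>k\<in>K. T k x)) \<in> exp_poly r (2 * D * card K)"
proof -
  have "(\<lambda>x. (den k x)\<^sup>2 * T k x * (\<Prod>j\<in>K - {k}. (den j x)\<^sup>2)) \<in> exp_poly r (2 * D * card K)"
    if k: "k \<in> K" for k
  proof (rule exp_poly_mono[OF exp_poly_mult[OF T[OF k] exp_poly_prod]])
    show "(\<lambda>x. (den j x)\<^sup>2) \<in> exp_poly r (D * 2)" if "j \<in> K - {k}" for j
      using that by (intro exp_poly_power den) auto
    show "2 * D + (\<Sum>j\<in>K - {k}. D * 2) \<le> 2 * D * card K"
      unfolding card.remove[OF K k] by (simp add: distrib_left)
  qed (use K in simp)
  moreover have "(\<Prod>j\<in>K. (den j x)\<^sup>2) * T k x = (den k x)\<^sup>2 * T k x * (\<Prod>j\<in>K - {k}. (den j x)\<^sup>2)"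
    if "k \<in> K" for k x
    unfolding prod.remove[OF K that, of "\<lambda>j. (den j x)\<^sup>2"] by (simp only: mult_ac)
  ultimately have "(\<lambda>x. (\<Prod>j\<in>K. (den j x)\<^sup>2) * T k x) \<in> exp_poly r (2 * D * card K)" if "k \<in> K" for k
    using that by (simp only:)
  then show ?thesis unfolding sum_distrib_left by (rule exp_poly_sum)
qed

text \<open>For a regular value \<open>v\<close>, the base points of its fibre are nondegenerate
  zeros of \<open>P\<close>, whose components have degree at most \<open>2 * l * w\<close> in each
  variable. The bound for nondegenerate zeros then applies.\<close>

lemma mdeg_sigmoid_sum_le:
  fixes a :: "nat \<Rightarrow> real ^ 'n" and b d :: "nat \<Rightarrow> real" and f :: "real ^ 'n \<Rightarrow> real"
  assumes q: "q > 0"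
    and a: "\<And>k i. k \<in> {1..w} \<Longrightarrow> real q * a k $ i \<in> \<int>"
    and l: "\<And>k i. k \<in> {1..w} \<Longrightarrow> \<bar>real q * a k $ i\<bar> \<le> real l"
    and f: "f = (\<lambda>x. c0 + (\<Sum>k=1..w. d k * sigmoid (a k \<bullet> x + b k)))"
    and V: "V = {x. f x = 0}" "smooth_hypersurface V"
    and grad: "\<And>x. x \<in> V \<Longrightarrow> \<exists>D. GDERIV f x :> D \<and> D \<noteq> 0"
  shows "mdeg V \<le> enat (fact CARD('n) * (2 * l * w) ^ CARD('n))"
proof (rule mdeg_le)
  fix v :: "real ^ 'n" and S
  assume v: "regular_value gauss_map (normal_sphere_bundle V) (sphere 0 1) v"
    and S: "finite S" "\<And>x. x \<in> S \<Longrightarrow> (x, v) \<in> normal_sphere_bundle V"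
  define r where "r = 1 / real q"
  have r: "r \<noteq> 0" using q by (simp add: r_def)
  \<comment> \<open>The numbers \<open>q * a k $ i\<close> are integers, so the floor is exact;
    \<open>nat\<close> truncates at 0 and thus extracts the positive part, and below the negative
    part.\<close>
  define p where "p = (\<lambda>k i. nat \<lfloor>real q * a k $ i\<rfloor>)"
  define m where "m = (\<lambda>k i. nat (- \<lfloor>real q * a k $ i\<rfloor>))"
  have pm: "p k i \<le> l" "m k i \<le> l" "r * (real (p k i) - real (m k i)) = a k $ i"
    if k: "k \<in> {1..w}" for k i
  proof -
    obtain z where z: "real q * a k $ i = of_int z" using a[OF k] Ints_cases by blast
    have "\<bar>of_int z\<bar> \<le> real l" using l[OF k, of i] z by simp
    then have "\<bar>z\<bar> \<le> int l" by linarith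
    then show "p k i \<le> l" "m k i \<le> l" by (auto simp: p_def m_def z)
    have "real (p k i) - real (m k i) = real q * a k $ i" by (simp add: p_def m_def z)
    then show "r * (real (p k i) - real (m k i)) = a k $ i" using q by (simp add: r_def)
  qed
  define den where "den = (\<lambda>k. sigmoid_denominator r (p k) (m k) (b k))"
  define g where "g = (\<lambda>x. \<Prod>k\<in>{1..w}. (den k x)\<^sup>2)"
  define \<sigma>' where "\<sigma>' = (\<lambda>u :: real. exp (- u) / (1 + exp (- u))\<^sup>2)"
  define G where "G = (\<lambda>x. \<Sum>k=1..w. (d k * \<sigma>' (a k \<bullet> x + b k)) *\<^sub>R a k)"
  define P where "P = (\<lambda>x. g x *\<^sub>R (f x *\<^sub>R v + (G x - (G x \<bullet> v) *\<^sub>R v)))"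
  have den_pos: "den k x > 0" for k x unfolding den_def by (rule sigmoid_denominator_pos)
  have den_app: "sigmoid_denominator r (p k) (m k) (b k) = den k" for k by (simp add: den_def)
  have den_nz: "den k x \<noteq> 0" for k x using den_pos[of k x] by simp
  have g_pos: "g x > 0" for x unfolding g_def by (auto intro!: prod_pos zero_less_power den_pos)
  have den_poly: "den k \<in> exp_poly r l" if "k \<in> {1..w}" for k
    unfolding den_def using pm(1,2)[OF that] by (rule sigmoid_denominator_in_exp_poly)
  have \<sigma>: "((\<lambda>y. sigmoid (a k \<bullet> y + b k)) has_derivative (\<lambda>h. \<sigma>' (a k \<bullet> x + b k) * (a k \<bullet> h))) (at x)" for k x
    unfolding \<sigma>'_def by (rule has_derivative_ridge[OF sigmoid_has_field_derivative])
  have fG: "(f has_derivative (\<lambda>h. h \<bullet> G x)) (at x)" for x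
    unfolding f G_def
    by (rule derivative_eq_intros \<sigma> refl)+
      (simp add: fun_eq_iff inner_sum_right inner_commute mult_ac)
  have G0: "G x \<noteq> 0" if x: "x \<in> V" for x
  proof
    assume "G x = 0"
    obtain D where D: "(f has_derivative (\<lambda>h. h \<bullet> D)) (at x)" "D \<noteq> 0"
      using grad[OF x] by (auto simp: gderiv_def)
    from fun_cong[OF has_derivative_unique[OF D(1) fG], of D] show False
      using D(2) \<open>G x = 0\<close> by simp
  qed
  obtain \<sigma>2 where \<sigma>2: "(\<sigma>' has_field_derivative \<sigma>2 u) (at u)" for u
    unfolding \<sigma>'_def using sigmoid_derivative_has_field_derivative by blast
  define G' where "G' = (\<lambda>x h. \<Sum>k=1..w. (d k * (\<sigma>2 (a k \<bullet> x + b k) * (a k \<bullet> h))) *\<^sub>R a k)"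
  have G': "(G has_derivative G' x) (at x)" for x
    unfolding G_def G'_def
    by (intro has_derivative_sum has_derivative_scaleR_left has_derivative_mult_right
        has_derivative_ridge \<sigma>2)
  have g_poly: "g \<in> exp_poly r (2 * l * w)"
  proof -
    have "g \<in> exp_poly r (\<Sum>k\<in>{1..w}. l * 2)"
      unfolding g_def by (rule exp_poly_prod, simp, rule exp_poly_power[OF den_poly])
    then show ?thesis by (simp add: mult_ac)
  qed
  have g': "(g has_derivative frechet_derivative g (at x)) (at x)" for x
    unfolding frechet_derivative_works[symmetric] using g_poly by (rule exp_poly_differentiable)
  have gf: "(\<lambda>x. g x * f x) \<in> exp_poly r (2 * l * w)"
  proof -
    have "(\<lambda>x. g x * (\<Sum>k\<in>{1..w}. d k * sigmoid (a k \<bullet> x + b k))) \<in> exp_poly r (2 * l * card {1..w})"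
      unfolding g_def
    proof (rule exp_poly_clear_denominators[OF _ den_poly])
      fix k assume k: "k \<in> {1..w}"
      \<comment> \<open>The sigmoid uses up one denominator; the remaining one has degree
        \<open>l\<close>, like the numerator.\<close>
      have "(den k x)\<^sup>2 * (d k * sigmoid (a k \<bullet> x + b k)) = d k * (exp_monomial r (p k) x * den k x)" for x
        using den_nz[of k x] unfolding sigmoid_eq(1)[OF r pm(3)[OF k]] den_app
        by (simp add: power2_eq_square)
      then show "(\<lambda>x. (den k x)\<^sup>2 * (d k * sigmoid (a k \<bullet> x + b k))) \<in> exp_poly r (2 * l)"
        unfolding mult_2 by (simp only:)
          (rule exp_poly_cmult exp_poly_mult exp_monomial_in_exp_poly pm(1)[OF k] den_poly[OF k])+
    qed auto
    moreover have "(\<lambda>x. c0 * g x) \<in> exp_poly r (2 * l * w)" using g_poly by (rule exp_poly_cmult)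
    ultimately have "(\<lambda>x. c0 * g x + g x * (\<Sum>k\<in>{1..w}. d k * sigmoid (a k \<bullet> x + b k)))
        \<in> exp_poly r (2 * l * w)" by (intro exp_poly.add) simp_all
    then show ?thesis by (simp only: f distrib_left mult.commute[of _ c0])
  qed
  have gG: "(\<lambda>x. g x * G x $ i) \<in> exp_poly r (2 * l * w)" for i
  proof -
    have "(\<lambda>x. g x * (\<Sum>k\<in>{1..w}. d k * \<sigma>' (a k \<bullet> x + b k) * a k $ i)) \<in> exp_poly r (2 * l * card {1..w})"
      unfolding g_def
    proof (rule exp_poly_clear_denominators[OF _ den_poly])
      fix k assume k: "k \<in> {1..w}"
      \<comment> \<open>The derivative uses up both denominators and leaves two monomials of degree
        at most \<open>l\<close> each.\<close>
      have "(den k x)\<^sup>2 * (d k * \<sigma>' (a k \<bullet> x + b k) * a k $ i) =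
          (d k * a k $ i * exp (- b k)) * (exp_monomial r (p k) x * exp_monomial r (m k) x)" for x
        using den_nz[of k x] unfolding \<sigma>'_def sigmoid_eq(2)[OF r pm(3)[OF k]] den_app
        by simp
      then show "(\<lambda>x. (den k x)\<^sup>2 * (d k * \<sigma>' (a k \<bullet> x + b k) * a k $ i)) \<in> exp_poly r (2 * l)"
        unfolding mult_2 by (simp only:)
          (rule exp_poly_cmult exp_poly_mult exp_monomial_in_exp_poly pm(1,2)[OF k])+
    qed auto
    then show ?thesis by (simp add: G_def)
  qed
  have P_poly: "(\<lambda>x. P x $ i) \<in> exp_poly r (2 * l * w)" for i
  proof -
    \<comment> \<open>For fixed \<open>v\<close> the projection combines the components of
      \<open>g G\<close> with constant coefficients, so it does not raise the degree.\<close>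
    have "(\<Sum>j\<in>UNIV. (- v $ j * v $ i) * (g x * G x $ j)) = - (g x * v $ i * (G x \<bullet> v))" for x
    proof -
      have "(\<Sum>j\<in>UNIV. (- v $ j * v $ i) * (g x * G x $ j)) = (\<Sum>j\<in>UNIV. - (g x * v $ i) * (G x $ j * v $ j))"
        by (intro sum.cong) simp_all
      also have "\<dots> = - (g x * v $ i) * (G x \<bullet> v)"
        unfolding sum_distrib_left[symmetric] by (simp add: inner_vec_def)
      finally show ?thesis by simp
    qed
    then have "P x $ i = v $ i * (g x * f x) + (g x * G x $ i + (\<Sum>j\<in>UNIV. (- v $ j * v $ i) * (g x * G x $ j)))" for x
      by (simp add: P_def right_diff_distrib distrib_left mult_ac)
    moreover have "(\<lambda>x. v $ i * (g x * f x) + (g x * G x $ i + (\<Sum>j\<in>UNIV. (- v $ j * v $ i) * (g x * G x $ j))))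
        \<in> exp_poly r (2 * l * w)"
      by (rule exp_poly.add exp_poly_cmult exp_poly_sum gf gG)+
    ultimately show ?thesis by simp
  qed
  show "card S \<le> fact CARD('n) * (2 * l * w) ^ CARD('n)"
  proof (rule card_nondegenerate_zeros_le[OF r P_poly S(1)])
    fix x assume "x \<in> S"
    note surj = regular_value_imp_surj_derivative[OF fG G' g' _ V G0 v S(2)[OF this]]
    have "g x \<noteq> 0" using g_pos[of x] by simp
    then show "P x = 0" "\<exists>P'. (P has_derivative P') (at x) \<and> surj P'"
      unfolding P_def by (simp_all only: surj not_False_eq_True)
  qed
qed

theorem proposition4p9:
  shows "\<exists>C :: nat \<Rightarrow> real \<Rightarrow> real.
    (\<forall>m\<ge>1. \<forall>L\<ge>0. C m L \<le> 2 * fact m * (2 * L) ^ m) \<and>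
    (\<forall>(w::nat) (q::nat) (c0::real) (a :: nat \<Rightarrow> real ^ 'n) (b :: nat \<Rightarrow> real) (d :: nat \<Rightarrow> real)
        (f :: real ^ 'n \<Rightarrow> real) (V :: (real ^ 'n) set) (L::real).
       w \<ge> 1 \<longrightarrow>
       q > 0 \<longrightarrow>
       (\<forall>k\<in>{1..w}. \<forall>i. a k $ i \<in> \<rat> \<and> real q * a k $ i \<in> \<int>) \<longrightarrow>
       f = (\<lambda>x. c0 + (\<Sum>k=1..w. d k * sigmoid (a k \<bullet> x + b k))) \<longrightarrow>
       \<not> f constant_on UNIV \<longrightarrow>
       V = {x. f x = 0} \<longrightarrow>
       L = real q * Max {\<bar>a k $ i\<bar> | k i. k \<in> {1..w}} \<longrightarrow>
       smooth_hypersurface V \<longrightarrow>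
       compact V \<longrightarrow>
       (\<forall>x\<in>V. \<exists>D. GDERIV f x :> D \<and> D \<noteq> 0) \<longrightarrow>
       ereal_of_enat (mdeg V) \<le> ereal (C CARD('n) L * real w ^ CARD('n)))"
\<comment> \<open>The witness, half of the permitted constant, is what the bound for nondegenerate
  zeros gives at degree \<open>2 * L * w\<close>.\<close>
proof (intro exI[of _ "\<lambda>m L. fact m * (2 * L) ^ m"] conjI allI impI)
  fix m :: nat and L :: real
  assume "L \<ge> 0"
  then show "fact m * (2 * L) ^ m \<le> 2 * fact m * (2 * L) ^ m" by simp
next
  fix w q :: nat and c0 :: real and a :: "nat \<Rightarrow> real ^ 'n" and b d :: "nat \<Rightarrow> real"
    and f :: "real ^ 'n \<Rightarrow> real" and V :: "(real ^ 'n) set" and L :: real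
  assume w: "w \<ge> 1" and q: "q > 0"
    and a: "\<forall>k\<in>{1..w}. \<forall>i. a k $ i \<in> \<rat> \<and> real q * a k $ i \<in> \<int>"
    and f: "f = (\<lambda>x. c0 + (\<Sum>k=1..w. d k * sigmoid (a k \<bullet> x + b k)))"
    and V: "V = {x. f x = 0}" "smooth_hypersurface V"
    and L: "L = real q * Max {\<bar>a k $ i\<bar> | k i. k \<in> {1..w}}"
    and grad: "\<forall>x\<in>V. \<exists>D. GDERIV f x :> D \<and> D \<noteq> 0"
  define A where "A = (\<lambda>(k, i). \<bar>a k $ i\<bar>) ` ({1..w} \<times> UNIV)"
  have A: "{\<bar>a k $ i\<bar> | k i. k \<in> {1..w}} = A" by (auto simp: A_def)
  have A': "finite A" "A \<noteq> {}" using w by (auto simp: A_def)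
  \<comment> \<open>The maximum is attained at an entry, and \<open>q\<close> times this entry is an
    integer; hence \<open>L\<close> is a natural number and can serve as the degree bound
    \<open>l\<close>.\<close>
  have "Max A \<in> A" using A' by (rule Max_in)
  then obtain k0 i0 where "k0 \<in> {1..w}" "Max A = \<bar>a k0 $ i0\<bar>" by (auto simp: A_def)
  then have "L = \<bar>real q * a k0 $ i0\<bar>" "real q * a k0 $ i0 \<in> \<int>"
    using a unfolding L A by (auto simp: abs_mult)
  then obtain z :: int where "L = \<bar>of_int z\<bar>" by (metis Ints_cases)
  then have l: "L = real (nat \<bar>z\<bar>)" by simp
  have "\<bar>real q * a k $ i\<bar> \<le> L" if "k \<in> {1..w}" for k i
  proof -
    have "\<bar>a k $ i\<bar> \<le> Max A" using A' that by (intro Max_ge) (auto simp: A_def)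
    then show ?thesis unfolding L A by (simp add: abs_mult mult_left_mono)
  qed
  then have "mdeg V \<le> enat (fact CARD('n) * (2 * nat \<bar>z\<bar> * w) ^ CARD('n))"
    using a grad unfolding l by (intro mdeg_sigmoid_sum_le[OF q _ _ f V]) auto
  then have "ereal_of_enat (mdeg V) \<le> ereal_of_enat (enat (fact CARD('n) * (2 * nat \<bar>z\<bar> * w) ^ CARD('n)))"
    by (simp only: ereal_of_enat_le_iff)
  also have "\<dots> = ereal (fact CARD('n) * (2 * L) ^ CARD('n) * real w ^ CARD('n))"
    unfolding l by (simp add: power_mult_distrib)
  finally show "ereal_of_enat (mdeg V) \<le> ereal (fact CARD('n) * (2 * L) ^ CARD('n) * real w ^ CARD('n))" .
qed

end
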